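(* Fix $a>0$ and $\xi_0\in\mathcal{S}_+$, where $\mathcal{S}_+=\{\xi=x+iy\in\mathbb{C}:\ x\ge 1,\ x-1-\tfrac12\log(x^2+y^2)=0\}$. Then there exist, for all sufficiently large real $b>0$, complex numbers $z^*_b$ satisfying ${}_1F_1(a;b;z^*_b)=0$ and $\lim_{b\to\infty} z^*_b/b=\xi_0$.
   Context: ${}_1F_1(a;b;z)=\sum_{k=0}^\infty \frac{(a)_k}{(b)_k}\frac{z^k}{k!}$ is Kummer's confluent hypergeometric function, with $(x)_k=\Gamma(x+k)/\Gamma(x)$. *)

theory Defs
  imports "HOL-Analysis.Analysis"
begin

definition hyp1F1 :: "complex \<Rightarrow> complex \<Rightarrow> complex \<Rightarrow> complex" where
  "hyp1F1 a b z = (\<Sum>k. pochhammer a k / pochhammer b k * z ^ k / fact k)"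

definition S_plus :: "complex set" where
  "S_plus = {\<xi>. Re \<xi> \<ge> 1 \<and> Re \<xi> - 1 - ln ((Re \<xi>)\<^sup>2 + (Im \<xi>)\<^sup>2) / 2 = 0}"

end

(*
  Euler's integral, rotated in the complex plane, splits 1F1(a;b;b xi) for Re xi > 1, Im xi > 0 into an
  endpoint term, which after multiplication by b^a Beta(a,b-a) tends to a nonzero limit, and a saddle
  point term of size exp(b phi(xi)) up to subexponential factors, where phi(xi) = Re xi - 1 - ln |xi|.
  The curve S_plus is phi = 0, Re xi >= 1. If the scaled functions had no zeros on a disc around a
  nonreal point of S_plus for arbitrarily large b, their holomorphic b-th roots would form a normal
  family; a limit has modulus 1 where phi < 0, hence is constant, which contradicts the exponential
  growth where phi > 0. The point xi = 1 is a limit of nonreal points of S_plus.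
*)
theory Submission
  imports Defs "HOL-Complex_Analysis.Complex_Analysis" "HOL-Real_Asymp.Real_Asymp"
begin

section \<open>Rotation of rays of integration\<close>

text \<open>With z = b xi, Euler's integrand is exp (b (xi (1 - s) + ln s)) times a factor
  independent of b. The saddle is s = 1/xi, where the exponent has real part b phi(xi); at the
  endpoint s = 1 the exponent is 0, so that the contribution there has order b^(-a). The two balance
  where phi = 0. The ray from 0 through 1/xi shares its start with the interval [0,1], so only the
  end at 1 needs a correction: turning the ray onto the positive axis produces the integral over
  [0,1] plus a phase times the integral over (1,oo), which converges because Re xi > 1 and
  concentrates at s = 1. The branch point 1 lies on that axis, hence the axis is reached only as a
  limit of rays from below. A direct comparison of the two terms would need asymptotics uniform in
  xi with the exact saddle prefactor. The normal family argument needs only pointwise limits, an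
  exponential rate at a single point, and a crude bound exp (M b) on the disc; this is why the
  Laplace estimates may lose a factor exp (kappa b).\<close>

lemma set_integrable_Gamma_kernel:
  fixes p c :: real
  assumes "p > -1" "c > 0"
  shows "set_integrable lborel {0<..} (\<lambda>r. r powr p * exp (- c * r))"
proof -
  have "(\<lambda>t. complex_of_real t powr (of_real (p + 1) - 1) / of_real (exp (c * t)))
          absolutely_integrable_on {0<..}"
    by (rule absolutely_integrable_Gamma_integral) (use assms in auto)
  then have "(\<lambda>t. norm (complex_of_real t powr (of_real (p + 1) - 1) / of_real (exp (c * t))))
          absolutely_integrable_on {0<..}"
    by (rule set_integrable_norm)
  then have "integrable lebesgue (\<lambda>r. indicator {0<..} r *\<^sub>R (r powr p * exp (- c * r)))"
    unfolding set_integrable_def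
    by (rule Bochner_Integration.integrable_cong[THEN iffD1, rotated -1])
       (auto simp: indicator_def norm_divide norm_powr_real_powr exp_minus field_simps)
  then show ?thesis
    unfolding set_integrable_def by (subst (asm) integrable_completion) auto
qed

lemma powr_times_exp_tendsto_0:
  fixes p k :: real
  assumes "p > 0" "k > 0"
  shows "((\<lambda>t. t powr p * exp (- k * t)) \<longlongrightarrow> 0) at_top"
    and "((\<lambda>t. t powr p * exp (- k * t)) \<longlongrightarrow> 0) (at_right 0)"
proof -
  show "((\<lambda>t. t powr p * exp (- k * t)) \<longlongrightarrow> 0) at_top"
    using assms by real_asymp
  have "((\<lambda>t. t powr p) \<longlongrightarrow> 0) (at_right 0)"
    using assms(1) by real_asymp
  then have "((\<lambda>t. t powr p * exp (- k * t)) \<longlongrightarrow> 0 * exp (- k * 0)) (at_right 0)"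
    by (intro tendsto_intros)
  then show "((\<lambda>t. t powr p * exp (- k * t)) \<longlongrightarrow> 0) (at_right 0)" by simp
qed

lemma set_lebesgue_integral_Gamma:
  fixes p :: real
  assumes "p > -1"
  shows "(LINT r:{0<..}|lborel. r powr p * exp (- r)) = Gamma (p + 1)"
proof -
  have "((\<lambda>t. t powr ((p + 1) - 1) / exp t) has_integral Gamma (p + 1)) {0..}"
    by (rule Gamma_integral_real) (use assms in auto)
  then have "((\<lambda>t. t powr p * exp (- t)) has_integral Gamma (p + 1)) {0..}"
    by (simp add: exp_minus field_simps)
  then have "((\<lambda>t. if t \<in> {0<..} then t powr p * exp (- t) else 0) has_integral Gamma (p + 1)) {0..}"
    by (rule has_integral_spike [of "{0}", rotated 2]) auto
  then have "((\<lambda>t. t powr p * exp (- t)) has_integral Gamma (p + 1)) {0<..}"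
    by (subst (asm) has_integral_restrict) auto
  moreover have "set_integrable lborel {0<..} (\<lambda>t. t powr p * exp (- t))"
    using set_integrable_Gamma_kernel[of p 1] assms by simp
  ultimately show ?thesis
    using set_borel_integral_eq_integral(2) integral_unique by metis
qed

lemma set_integrable_bound_continuous:
  fixes f :: "real \<Rightarrow> complex" and g :: "real \<Rightarrow> real"
  assumes "set_integrable lborel S g" "continuous_on S f" "S \<in> sets borel"
    and "\<And>r. r \<in> S \<Longrightarrow> norm (f r) \<le> g r"
  shows "set_integrable lborel S f"
  unfolding set_integrable_def
proof (rule Bochner_Integration.integrable_bound)
  show "integrable lborel (\<lambda>r. indicator S r *\<^sub>R g r)"
    using assms(1) unfolding set_integrable_def .
  show "(\<lambda>r. indicator S r *\<^sub>R f r) \<in> borel_measurable lborel"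
    using borel_measurable_continuous_on_indicator[OF assms(3,2)] by simp
  show "AE x in lborel. norm (indicator S x *\<^sub>R f x) \<le> norm (indicator S x *\<^sub>R g x)"
    using assms(4) by (auto simp: indicator_def intro!: AE_I2 order_trans[OF _ abs_ge_self])
qed

text \<open>Multiplication by \<open>u\<close> carries the real segment to the segment in direction
  \<open>u\<close>; this is the bridge between integrals over rays and Cauchy's theorem.\<close>

lemma has_contour_integral_linepath_scaled:
  fixes u :: complex and G :: "complex \<Rightarrow> complex" and p q :: real
  assumes "p < q"
  shows "(G has_contour_integral I) (linepath (u * of_real p) (u * of_real q)) \<longleftrightarrow>
         ((\<lambda>r. u * G (u * of_real r)) has_integral I) {p..q}"
proof -
  have "linepath (u * of_real p) (u * of_real q) x = u * linepath (of_real p) (of_real q) x" for x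
    by (simp add: linepath_def scaleR_conv_of_real algebra_simps)
  then have "(G has_contour_integral I) (linepath (u * of_real p) (u * of_real q)) \<longleftrightarrow>
      ((\<lambda>z. u * G (u * z)) has_contour_integral I) (linepath (of_real p) (of_real q))"
    unfolding has_contour_integral_linepath by (simp add: algebra_simps)
  also have "\<dots> \<longleftrightarrow> ((\<lambda>r. u * G (u * of_real r)) has_integral I) {p..q}"
    using assms by (subst has_contour_integral_linepath_Reals_iff) auto
  finally show ?thesis .
qed

text \<open>Cauchy's theorem on the quadrilateral with corners \<open>u/n\<close>, \<open>nu\<close>, \<open>nv\<close>, \<open>v/n\<close>; working on an
  open cone keeps the possible singularity of \<open>G\<close> at the apex out of the contour.\<close>

lemma integral_over_ray_eq:
  fixes G :: "complex \<Rightarrow> complex" and C q c :: real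
  assumes S: "open S" "convex S" "0 \<notin> S"
    and cone: "\<And>s t. s \<in> S \<Longrightarrow> t > 0 \<Longrightarrow> s * of_real t \<in> S"
    and holo: "G holomorphic_on S"
    and bound: "\<And>s. s \<in> S \<Longrightarrow> norm (G s) \<le> C * norm s powr q * exp (- c * norm s)"
    and q: "q > -1" and c: "c > 0" and u: "u \<in> S" and v: "v \<in> S"
  shows "set_integrable lborel {0<..} (\<lambda>r. u * G (u * of_real r))"
    and "(LINT r:{0<..}|lborel. u * G (u * of_real r)) = (LINT r:{0<..}|lborel. v * G (v * of_real r))"
proof -
  have cont: "continuous_on S G" using holo by (rule holomorphic_on_imp_continuous_on)
  have int: "set_integrable lborel {0<..} (\<lambda>r. w * G (w * of_real r))" if w: "w \<in> S" for w
  proof (rule set_integrable_bound_continuous)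
    have "norm w > 0" using w S by auto
    then show "set_integrable lborel {0<..}
        (\<lambda>r. (norm w * C * norm w powr q) * (r powr q * exp (- (c * norm w) * r)))"
      using q c by (intro set_integrable_mult_right set_integrable_Gamma_kernel) auto
    show "continuous_on {0<..} (\<lambda>r. w * G (w * of_real r))"
      by (intro continuous_intros continuous_on_compose2[OF cont]) (auto intro: cone w)
    show "norm (w * G (w * of_real r)) \<le> norm w * C * norm w powr q * (r powr q * exp (- (c * norm w) * r))"
      if "r \<in> {0<..}" for r
      using mult_left_mono[OF bound[OF cone[OF w, of r]], of "norm w"] that
      by (simp add: norm_mult powr_mult mult_ac)
  qed auto
  from int[OF u] show "set_integrable lborel {0<..} (\<lambda>r. u * G (u * of_real r))" .
  define I where "I w n = contour_integral (linepath (w * of_real (1 / real n)) (w * of_real (real n))) G"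
    for w n
  \<comment> \<open>The shift by 2 guarantees \<open>1 / (n + 2) < n + 2\<close>, so that no
    truncated segment is degenerate.\<close>
  have lim: "(\<lambda>n. I w (n + 2)) \<longlonglongrightarrow> (LINT r:{0<..}|lborel. w * G (w * of_real r))" if w: "w \<in> S" for w
  proof -
    let ?A = "\<lambda>n. {1 / real (n + 2)..real (n + 2)}"
    have un: "(\<Union>n. ?A n) = {0<..}"
    proof (intro equalityI subsetI)
      fix x :: real assume x: "x \<in> {0<..}"
      obtain n where "real n > max x (1 / x)" using reals_Archimedean2 by blast
      then have "x \<in> ?A n" using x by (auto simp: field_simps)
      then show "x \<in> (\<Union>n. ?A n)" by blast
    qed (auto elim!: less_le_trans[rotated])
    have eq: "(LINT r:?A n|lborel. w * G (w * of_real r)) = I w (n + 2)" for n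
    proof -
      have "set_integrable lborel (?A n) (\<lambda>r. w * G (w * of_real r))"
        by (rule set_integrable_subset[OF int[OF w]]) (use un in auto)
      note si = set_borel_integral_eq_integral[OF this]
      have "((\<lambda>r. w * G (w * of_real r)) has_integral (LINT r:?A n|lborel. w * G (w * of_real r))) (?A n)"
        unfolding si(2) by (rule integrable_integral[OF si(1)])
      moreover have "1 / real (n + 2) < real (n + 2)"
        by (simp add: field_simps) (smt (verit) mult_nonneg_nonneg of_nat_0_le_iff)
      ultimately show ?thesis unfolding I_def
        using has_contour_integral_linepath_scaled contour_integral_unique by metis
    qed
    have "(\<lambda>n. LINT r:?A n|lborel. w * G (w * of_real r))
        \<longlonglongrightarrow> (LINT r:(\<Union>n. ?A n)|lborel. w * G (w * of_real r))"
    proof (rule set_integral_cont_up)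
      show "set_integrable lborel (\<Union>n. ?A n) (\<lambda>r. w * G (w * of_real r))"
        using int[OF w] unfolding un .
    qed (auto simp: incseq_def field_simps)
    then show ?thesis unfolding un eq .
  qed
  \<comment> \<open>\<open>L\<close> is the transversal side of the quadrilateral. It has to vanish
    both for \<open>t\<close> tending to infinity and for \<open>t\<close> tending to 0.\<close>
  define L where "L t = contour_integral (linepath (u * of_real t) (v * of_real t)) G" for t
  have seg: "closed_segment x y \<subseteq> S" if "x \<in> S" "y \<in> S" for x y
    using that S closed_segment_subset by blast
  have sumzero: "I u n + L (real n) - I v n - L (1 / real n) = 0" if "n > 0" for n
  proof -
    let ?a = "u * of_real (1 / real n)" and ?b = "u * of_real (real n)"
    let ?c = "v * of_real (real n)" and ?d = "v * of_real (1 / real n)"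
    have mem: "?a \<in> S" "?b \<in> S" "?c \<in> S" "?d \<in> S"
      using that by (auto intro!: cone u v simp del: of_real_divide of_real_of_nat_eq)
    have ci: "G contour_integrable_on linepath x y" if "x \<in> S" "y \<in> S" for x y
      using contour_integrable_continuous_linepath continuous_on_subset[OF cont] seg that by metis
    have "(G has_contour_integral 0) (linepath ?a ?b +++ linepath ?b ?c +++ linepath ?c ?d +++ linepath ?d ?a)"
      by (rule Cauchy_theorem_convex_simple[OF holo S(2)])
         (use seg mem in \<open>auto simp: path_image_join simp del: of_real_divide of_real_of_nat_eq\<close>)
    then have "contour_integral (linepath ?a ?b) G + contour_integral (linepath ?b ?c) G
         + contour_integral (linepath ?c ?d) G + contour_integral (linepath ?d ?a) G = 0"
      using ci mem by (auto dest!: contour_integral_unique simp: add.assoc simp del: of_real_divide of_real_of_nat_eq)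
    moreover have "contour_integral (linepath ?c ?d) G = - I v n"
      unfolding I_def by (metis (no_types) contour_integral_reverse_linepath seg mem cont continuous_on_subset minus_minus)
    moreover have "contour_integral (linepath ?d ?a) G = - L (1 / real n)"
      unfolding L_def by (metis (no_types) contour_integral_reverse_linepath seg mem cont continuous_on_subset minus_minus)
    ultimately show ?thesis
      by (simp add: I_def L_def algebra_simps del: of_real_divide of_real_of_nat_eq)
  qed
  obtain m where m: "m > 0" "\<And>w. w \<in> closed_segment u v \<Longrightarrow> m \<le> norm w"
  proof -
    have "0 \<notin> closed_segment u v" using seg[OF u v] S by auto
    then have pos: "\<forall>w\<in>closed_segment u v. 0 < norm w" by auto
    have "closed_segment u v \<noteq> {}" using ends_in_segment by blast
    then obtain w0 where "w0 \<in> closed_segment u v" "\<forall>w\<in>closed_segment u v. norm w0 \<le> norm w"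
      using continuous_attains_inf[of "closed_segment u v" norm] compact_segment continuous_on_norm_id
      by blast
    then show ?thesis using that[of "norm w0"] pos by blast
  qed
  obtain M where M: "\<And>w. w \<in> closed_segment u v \<Longrightarrow> norm w \<le> M"
    using compact_imp_bounded[OF compact_segment] bounded_iff by metis
  \<comment> \<open>The exponent \<open>q\<close> may have either sign, so
    \<open>norm w powr q\<close> is largest at one or the other end of \<open>[m, M]\<close>; the
    sum covers both cases. The length \<open>norm (v - u) * t\<close> of the side raises the power
    of \<open>t\<close> to \<open>q + 1 > 0\<close>, which gives the decay at 0.\<close>
  define K where "K = \<bar>C\<bar> * (m powr q + M powr q) * norm (v - u)"
  have K: "norm (L t) \<le> K * (t powr (q + 1) * exp (- (c * m) * t))" if t: "t > 0" for t
  proof -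
    have st: "u * of_real t \<in> S" "v * of_real t \<in> S" using cone u v t by auto
    have "norm (L t) \<le> (\<bar>C\<bar> * ((m powr q + M powr q) * t powr q) * exp (- (c * m) * t))
        * norm (v * of_real t - u * of_real t)"
      unfolding L_def
    proof (rule contour_integral_bound_linepath)
      show "G contour_integrable_on linepath (u * of_real t) (v * of_real t)"
        using contour_integrable_continuous_linepath continuous_on_subset[OF cont] seg st by metis
      fix x assume x: "x \<in> closed_segment (u * of_real t) (v * of_real t)"
      then obtain l where l: "0 \<le> l" "l \<le> 1" "x = (1 - l) *\<^sub>R (u * of_real t) + l *\<^sub>R (v * of_real t)"
        by (auto simp: in_segment)
      define w where "w = (1 - l) *\<^sub>R u + l *\<^sub>R v"
      have w: "w \<in> closed_segment u v" "x = w * of_real t"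
        using l by (auto simp: in_segment w_def scaleR_conv_of_real algebra_simps)
      have nw: "m \<le> norm w" "norm w \<le> M" using m(2) M w(1) by auto
      then have nw': "norm w > 0" using m(1) by linarith
      have "norm w powr q \<le> m powr q + M powr q"
        using nw m(1) powr_mono2[of q "norm w" M] powr_mono2'[of q m "norm w"]
        by (cases "q \<ge> 0") (simp_all add: add_increasing add_increasing2)
      moreover have "exp (- c * norm x) \<le> exp (- (c * m) * t)"
        using nw c t w by (simp add: norm_mult)
      moreover have "norm x powr q = norm w powr q * t powr q"
        using w t by (simp add: norm_mult powr_mult)
      moreover have "norm (G x) \<le> C * norm x powr q * exp (- c * norm x)"
        using bound[of x] seg[OF st] x by blast
      moreover have "C * norm x powr q * exp (- c * norm x)
          \<le> \<bar>C\<bar> * ((m powr q + M powr q) * t powr q) * exp (- (c * m) * t)"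
        using calculation by (intro mult_mono) (auto intro!: mult_right_mono)
      ultimately show "norm (G x) \<le> \<bar>C\<bar> * ((m powr q + M powr q) * t powr q) * exp (- (c * m) * t)"
        by linarith
    qed auto
    also have "norm (v * of_real t - u * of_real t) = norm (v - u) * t"
      using t by (metis left_diff_distrib norm_mult norm_of_real abs_of_pos)
    finally show ?thesis using t by (simp add: K_def powr_add mult_ac)
  qed
  have cm: "c * m > 0" using c m by simp
  have "((\<lambda>t. K * (t powr (q + 1) * exp (- (c * m) * t))) \<longlongrightarrow> 0) at_top"
    by (rule tendsto_mult_right_zero, rule powr_times_exp_tendsto_0) (use q cm in auto)
  then have L1: "(\<lambda>n. K * (real (n+2) powr (q + 1) * exp (- (c * m) * real (n+2)))) \<longlonglongrightarrow> 0"
    by (rule filterlim_compose) real_asymp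
  have "((\<lambda>t. K * (t powr (q + 1) * exp (- (c * m) * t))) \<longlongrightarrow> 0) (at_right 0)"
    by (rule tendsto_mult_right_zero, rule powr_times_exp_tendsto_0) (use q cm in auto)
  moreover have "filterlim (\<lambda>n. 1 / real (n+2)) (at_right 0) sequentially"
    by real_asymp
  ultimately have L2: "(\<lambda>n. K * ((1 / real (n+2)) powr (q + 1) * exp (- (c * m) * (1 / real (n+2))))) \<longlonglongrightarrow> 0"
    by (rule filterlim_compose)
  have "(\<lambda>n. L (real (n+2))) \<longlonglongrightarrow> 0"
    by (rule Lim_null_comparison[OF _ L1]) (use K in auto)
  moreover have "(\<lambda>n. L (1 / real (n+2))) \<longlonglongrightarrow> 0"
    by (rule Lim_null_comparison[OF _ L2]) (intro always_eventually allI K, simp)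
  ultimately have "(\<lambda>n. I u (n+2) + L (real (n+2)) - I v (n+2) - L (1 / real (n+2)))
      \<longlonglongrightarrow> (LINT r:{0<..}|lborel. u * G (u * of_real r)) + 0 - (LINT r:{0<..}|lborel. v * G (v * of_real r)) - 0"
    by (intro tendsto_intros lim u v)
  moreover have "I u (n+2) + L (real (n+2)) - I v (n+2) - L (1 / real (n+2)) = 0" for n
    by (rule sumzero) simp
  ultimately have "(\<lambda>n. 0) \<longlonglongrightarrow> (LINT r:{0<..}|lborel. u * G (u * of_real r)) + 0
      - (LINT r:{0<..}|lborel. v * G (v * of_real r)) - 0"
    by (simp only:)
  then show "(LINT r:{0<..}|lborel. u * G (u * of_real r)) = (LINT r:{0<..}|lborel. v * G (v * of_real r))"
    by (simp add: LIMSEQ_const_iff)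
qed

section \<open>Euler's integral\<close>

text \<open>Expanding the exponential and integrating termwise gives
  \<open>Beta (b - a) (a + k)\<close>, and the ratio of Gamma values produces the Pochhammer
  quotient. The usual Euler integral is reflected by s to 1 - s: the large exponent then sits at 0,
  the apex of the rays to be rotated, and the branch point of fixed exponent at 1.\<close>

lemma hyp1F1_Euler_integral:
  fixes a b :: real and z :: complex
  assumes a: "a > 0" and b: "b > a"
  defines "w \<equiv> \<lambda>s. s powr (b - a - 1) * (1 - s) powr (a - 1)"
  shows "(\<lambda>k. of_real (Beta a (b - a)) * (pochhammer (of_real a) k / pochhammer (of_real b) k * z ^ k / fact k))
           sums (LINT s:{0..1}|lborel. exp (z * of_real (1 - s)) * of_real (w s))"
proof -
  let ?f = "\<lambda>k s. indicator {0..1} s *\<^sub>R (of_real (w s) * (z * of_real (1 - s)) ^ k / fact k) :: complex"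
  \<comment> \<open>At \<open>s = 1\<close> both sides are 0 for every \<open>k\<close>, since
    \<open>0 powr x = 0\<close> for all \<open>x\<close>.\<close>
  have wk: "w s * (1 - s) ^ k = s powr ((b - a) - 1) * (1 - s) powr ((a + real k) - 1)" if "s \<in> {0..1}" for s k
  proof (cases "s = 1")
    case False
    then have "(1 - s) ^ k = (1 - s) powr real k" using that by (simp add: powr_realpow)
    moreover have "(1 - s) powr ((a + real k) - 1) = (1 - s) powr (a - 1) * (1 - s) powr real k"
      by (simp add: powr_add[symmetric] algebra_simps)
    ultimately show ?thesis by (simp add: w_def)
  qed (simp add: w_def)
  have hB: "has_bochner_integral lborel (\<lambda>s. indicator {0..1} s *\<^sub>R (w s * (1 - s) ^ k)) (Beta (b - a) (a + real k))" for k
  proof -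
    let ?g = "\<lambda>s. s powr ((b - a) - 1) * (1 - s) powr ((a + real k) - 1)"
    have si: "set_integrable lborel {0..1} ?g" by (rule integrable_Beta) (use a b in auto)
    moreover have "(LINT s:{0..1}|lborel. ?g s) = Beta (b - a) (a + real k)"
      using set_borel_integral_eq_integral(2)[OF si] has_integral_Beta_real[of "b - a" "a + real k"] a b
      by (simp add: integral_unique)
    ultimately have "has_bochner_integral lborel (\<lambda>s. indicator {0..1} s *\<^sub>R ?g s) (Beta (b - a) (a + real k))"
      by (simp add: has_bochner_integral_iff set_integrable_def set_lebesgue_integral_def)
    also have "(\<lambda>s. indicator {0..1} s *\<^sub>R ?g s) = (\<lambda>s. indicator {0..1} s *\<^sub>R (w s * (1 - s) ^ k))"
      using wk by (auto simp: indicator_def fun_eq_iff)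
    finally show ?thesis .
  qed
  have hf: "has_bochner_integral lborel (?f k) (of_real (Beta (b - a) (a + real k)) * (z ^ k / fact k))" for k
  proof -
    have "?f k = (\<lambda>s. of_real (indicator {0..1} s *\<^sub>R (w s * (1 - s) ^ k)) * (z ^ k / fact k))"
      by (auto simp: fun_eq_iff indicator_def power_mult_distrib)
    then show ?thesis
      by (simp only: has_bochner_integral_mult_left[OF has_bochner_integral_of_real[OF hB]])
  qed
  have [simp]: "norm (1 - complex_of_real s) = \<bar>1 - s\<bar>" for s
    by (metis norm_of_real of_real_1 of_real_diff)
  have hn: "has_bochner_integral lborel (\<lambda>s. norm (?f k s)) (Beta (b - a) (a + real k) * (norm z ^ k / fact k))" for k
  proof -
    have "(\<lambda>s. norm (?f k s)) = (\<lambda>s. (indicator {0..1} s *\<^sub>R (w s * (1 - s) ^ k)) * (norm z ^ k / fact k))"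
      by (auto simp: fun_eq_iff indicator_def power_mult_distrib norm_mult norm_divide norm_power w_def)
    then show ?thesis
      by (simp only: has_bochner_integral_mult_left[OF hB])
  qed
  have ratio: "Beta (b - a) (a + real k) = Beta a (b - a) * (pochhammer a k / pochhammer b k)" for k
  proof -
    have "pochhammer a k = Gamma (a + real k) / Gamma a" "pochhammer b k = Gamma (b + real k) / Gamma b"
      using a b by (auto intro!: pochhammer_Gamma elim!: nonpos_Ints_cases)
    moreover have "Gamma a > 0" "Gamma b > 0" "Gamma (b + real k) > 0" using a b by auto
    ultimately show ?thesis by (simp add: Beta_def field_simps)
  qed
  have expo: "(\<lambda>k. ?f k s) sums (indicator {0..1} s *\<^sub>R (exp (z * of_real (1 - s)) * of_real (w s)))" for s
  proof -
    have "(\<lambda>k. indicator {0..1} s *\<^sub>R (of_real (w s) * ((z * of_real (1 - s)) ^ k /\<^sub>R fact k)))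
        sums (indicator {0..1} s *\<^sub>R (of_real (w s) * exp (z * of_real (1 - s))))"
      by (intro sums_scaleR_right sums_mult exp_converges)
    then show ?thesis by (simp add: scaleR_conv_of_real field_simps)
  qed
  have sn: "summable (\<lambda>k. norm (?f k s))" for s
  proof -
    have "summable (\<lambda>k. norm (of_real (indicator {0..1} s * w s) * ((z * of_real (1 - s)) ^ k /\<^sub>R fact k)))"
      unfolding norm_mult by (intro summable_mult summable_norm_exp)
    then show ?thesis by (simp add: norm_mult norm_divide divide_simps mult_ac)
  qed
  \<comment> \<open>Monotonicity of Beta dominates the integrals of the norms by an exponential
    series, as the exchange of sum and integral requires.\<close>
  have bet: "Beta (b - a) (a + real k) \<le> Beta (b - a) a" for k
    by (rule Beta_real_mono) (use a b in auto)
  have bpos: "\<bar>Beta (b - a) (a + real k)\<bar> = Beta (b - a) (a + real k)" for k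
    using a b by (simp add: Beta_def)
  have "summable (\<lambda>k. Beta (b - a) a * (norm z ^ k /\<^sub>R fact k))"
    by (intro summable_mult summable_exp_generic)
  then have "summable (\<lambda>k. Beta (b - a) (a + real k) * (norm z ^ k / fact k))"
    by (rule summable_comparison_test')
       (use bet bpos in \<open>auto simp: divide_simps abs_mult intro!: mult_right_mono\<close>)
  then have sI: "summable (\<lambda>k. LINT s|lborel. norm (?f k s))"
    using hn by (simp add: has_bochner_integral_iff)

  have si: "(\<lambda>s. \<Sum>k. ?f k s) = (\<lambda>s. indicator {0..1} s *\<^sub>R (exp (z * of_real (1 - s)) * of_real (w s)))"
    using expo by (auto simp: sums_iff)
  have "(\<lambda>k. LINT s|lborel. ?f k s) sums (LINT s|lborel. (\<Sum>k. ?f k s))"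
    by (rule sums_integral[OF hf[unfolded has_bochner_integral_iff, THEN conjunct1] AE_I2[OF sn] sI])
  then show ?thesis
    unfolding si set_lebesgue_integral_def
    using hf by (simp add: has_bochner_integral_iff ratio pochhammer_of_real mult_ac)

qed

text \<open>The Beta factor is nonzero and can be cancelled, so convergence of the defining series
  comes along with the integral formula.\<close>

lemma hyp1F1_Euler:
  fixes a b :: real and z :: complex
  assumes "a > 0" "b > a"
  shows "of_real (Beta a (b - a)) * hyp1F1 (of_real a) (of_real b) z =
           (LINT s:{0..1}|lborel. exp (z * of_real (1 - s)) * of_real (s powr (b - a - 1) * (1 - s) powr (a - 1)))"
    and "(\<lambda>k. pochhammer (of_real a) k / pochhammer (of_real b) k * z ^ k / fact k)
           sums hyp1F1 (of_real a) (of_real b) z"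
proof -
  have "Beta a (b - a) > 0" using assms by (simp add: Beta_def)
  then have nz: "complex_of_real (Beta a (b - a)) \<noteq> 0" by simp
  note sums = hyp1F1_Euler_integral[OF assms, of z]
  then have "summable (\<lambda>k. of_real (Beta a (b - a)) *
      (pochhammer (of_real a) k / pochhammer (of_real b) k * z ^ k / fact k))"
    by (rule sums_summable)
  then have sm: "summable (\<lambda>k. pochhammer (of_real a) k / pochhammer (of_real b) k * z ^ k / fact k)"
    using nz by (simp only: summable_cmult_iff) simp
  then show *: "(\<lambda>k. pochhammer (of_real a) k / pochhammer (of_real b) k * z ^ k / fact k)
           sums hyp1F1 (of_real a) (of_real b) z"
    unfolding hyp1F1_def by (rule summable_sums)
  from sums_unique2[OF sums_mult[OF *] sums]
  show "of_real (Beta a (b - a)) * hyp1F1 (of_real a) (of_real b) z =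
           (LINT s:{0..1}|lborel. exp (z * of_real (1 - s)) * of_real (s powr (b - a - 1) * (1 - s) powr (a - 1)))" .
qed

lemma hyp1F1_holomorphic:
  fixes a b :: real
  assumes "a > 0" "b > a"
  shows "hyp1F1 (of_real a) (of_real b) holomorphic_on S"
proof -
  have "hyp1F1 (of_real a) (of_real b) holomorphic_on ball 0 r" for r
  proof (rule power_series_holomorphic)
    show "(\<lambda>n. (pochhammer (of_real a) n / pochhammer (of_real b) n / fact n) * (w - 0) ^ n)
        sums hyp1F1 (of_real a) (of_real b) w" for w
      using hyp1F1_Euler(2)[OF assms, of w] by (simp add: mult_ac)
  qed
  then have "hyp1F1 (of_real a) (of_real b) field_differentiable at z" for z
    by (rule holomorphic_on_imp_differentiable_at[of _ "ball 0 (norm z + 1)"]) auto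
  then show ?thesis
    by (auto simp: holomorphic_on_def intro: field_differentiable_at_within)
qed

text \<open>The coefficients are real; this transfers zeros between the upper and the lower half
  plane.\<close>

lemma hyp1F1_cnj:
  fixes a b :: real
  assumes "a > 0" "b > a"
  shows "hyp1F1 (of_real a) (of_real b) (cnj z) = cnj (hyp1F1 (of_real a) (of_real b) z)"
proof -
  have "(\<lambda>k. cnj (pochhammer (of_real a) k / pochhammer (of_real b) k * z ^ k / fact k))
      sums cnj (hyp1F1 (of_real a) (of_real b) z)"
    using hyp1F1_Euler(2)[OF assms] by (simp only: sums_cnj)
  moreover have "cnj (pochhammer (of_real a) k / pochhammer (of_real b) k * z ^ k / fact k)
      = pochhammer (of_real a) k / pochhammer (of_real b) k * cnj z ^ k / fact k" for k
    by (simp add: pochhammer_of_real[symmetric])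
  ultimately show ?thesis using hyp1F1_Euler(2)[OF assms, of "cnj z"] sums_unique2 by simp
qed

text \<open>For \<open>b > a > 0\<close> the Pochhammer quotients lie between 0 and 1. At the
  argument \<open>b * \<xi>\<close> this gives the bound of exponential type in \<open>b\<close>
  that makes the family of roots normal.\<close>

lemma norm_hyp1F1_le:
  fixes a b :: real
  assumes "a > 0" "b > a"
  shows "norm (hyp1F1 (of_real a) (of_real b) z) \<le> exp (norm z)"
proof -
  let ?c = "\<lambda>k. pochhammer a k / pochhammer b k"
  have c: "0 \<le> ?c k \<and> ?c k \<le> 1" for k
  proof -
    have "0 \<le> pochhammer a k" "0 < pochhammer b k"
      using assms by (auto intro: pochhammer_nonneg pochhammer_pos)
    moreover have "pochhammer a k \<le> pochhammer b k"
      unfolding pochhammer_prod using assms by (intro prod_mono) auto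
    ultimately show ?thesis by simp
  qed
  have s: "(\<lambda>k. norm z ^ k / fact k) sums exp (norm z)"
    using exp_converges[of "norm z"] by (simp add: scaleR_conv_of_real field_simps)
  have "norm (hyp1F1 (of_real a) (of_real b) z) \<le> (\<Sum>k. norm z ^ k / fact k)"
    unfolding hyp1F1_def
  proof (rule norm_suminf_le)
    show "norm (pochhammer (of_real a) n / pochhammer (of_real b) n * z ^ n / fact n) \<le> norm z ^ n / fact n" for n
    proof -
      have "norm (pochhammer (of_real a) n / pochhammer (of_real b) n * z ^ n / fact n) = \<bar>?c n\<bar> * (norm z ^ n / fact n)"
        by (simp add: pochhammer_of_real norm_mult norm_divide norm_power)
      also have "\<dots> \<le> 1 * (norm z ^ n / fact n)" using c[of n] by (intro mult_right_mono) auto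
      finally show ?thesis by simp
    qed
    show "summable (\<lambda>n. norm z ^ n / fact n)" using s by (rule sums_summable)
  qed
  then show ?thesis using s by (simp add: sums_iff)
qed

section \<open>The connection formula\<close>

lemma powr_le_exp:
  fixes x p :: real
  assumes "x \<ge> 0"
  shows "(1 + x) powr p \<le> exp (\<bar>p\<bar> * x)"
proof -
  have "(1 + x) powr p \<le> (1 + x) powr \<bar>p\<bar>" using assms by (intro powr_mono) auto
  also have "\<dots> \<le> exp x powr \<bar>p\<bar>" using assms by (intro powr_mono2) (auto simp: exp_ge_add_one_self)
  also have "\<dots> = exp (\<bar>p\<bar> * x)" by (simp add: powr_def)
  finally show ?thesis .
qed

text \<open>The principal power jumps at the limit point, but \<open>- f n\<close> tends to the
  positive real \<open>t\<close>, where it is continuous, and in the upper half plane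
  \<open>Ln (f n) = Ln (- f n) + \<i> * pi\<close>.\<close>

lemma tendsto_powr_negative_real_from_above:
  fixes t p :: real and f :: "'a \<Rightarrow> complex"
  assumes "(f \<longlongrightarrow> - of_real t) F" "t > 0" "\<And>n. Im (f n) > 0"
  shows "((\<lambda>n. f n powr of_real p) \<longlongrightarrow> of_real (t powr p) * exp (\<i> * pi * p)) F"
proof -
  have eq: "f n powr of_real p = (- f n) powr of_real p * exp (\<i> * pi * p)" for n
  proof -
    have nz: "f n \<noteq> 0" using assms(3)[of n] by auto
    then have "Ln (- f n) = Ln (f n) - \<i> * pi"
      using assms(3)[of n] by (subst Ln_minus) auto
    then have "Ln (f n) = Ln (- f n) + \<i> * pi" by simp
    then show ?thesis using nz by (simp add: powr_def exp_add[symmetric] algebra_simps)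
  qed
  have "((\<lambda>n. - f n) \<longlongrightarrow> of_real t) F" using tendsto_minus[OF assms(1)] by simp
  then have "((\<lambda>n. (- f n) powr of_real p) \<longlongrightarrow> of_real t powr of_real p) F"
    using assms(2) by (intro tendsto_powr_complex tendsto_const) auto
  then have "((\<lambda>n. (- f n) powr of_real p) \<longlongrightarrow> of_real (t powr p)) F"
    using assms(2) by (simp add: powr_of_real)
  then show ?thesis unfolding eq by (intro tendsto_intros)
qed

lemma set_integrable_Kummer_tail:
  fixes c d l :: real
  assumes "c \<ge> 0" "d > -1" "l > c"
  shows "set_integrable lborel {0<..} (\<lambda>t. exp (- l * t) * ((1 + t) powr c * t powr d))"
  unfolding set_integrable_def
proof (rule Bochner_Integration.integrable_bound)
  show "integrable lborel (\<lambda>t. indicator {0<..} t *\<^sub>R (t powr d * exp (- (l - c) * t)))"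
    using set_integrable_Gamma_kernel[of d "l - c"] assms unfolding set_integrable_def by simp
  have "exp (- l * t) * ((1 + t) powr c * t powr d) \<le> t powr d * exp (- (l - c) * t)" if "t > 0" for t
  proof -
    have "exp (- l * t) * ((1 + t) powr c * t powr d) \<le> exp (- l * t) * (exp (c * t) * t powr d)"
      using powr_le_exp[of t c] that assms by (intro mult_left_mono mult_right_mono) auto
    also have "\<dots> = t powr d * exp (- (l - c) * t)"
      by (simp add: mult_exp_exp[symmetric] algebra_simps exp_add[symmetric])
    finally show ?thesis .
  qed
  then show "AE t in lborel. norm (indicator {0<..} t *\<^sub>R (exp (- l * t) * ((1 + t) powr c * t powr d)))
      \<le> norm (indicator {0<..} t *\<^sub>R (t powr d * exp (- (l - c) * t)))"
    by (auto simp: indicator_def)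
qed measurable

lemma set_integrable_shift_1:
  fixes f :: "real \<Rightarrow> 'a::{banach, second_countable_topology}"
  shows "set_integrable lborel {1<..} f \<longleftrightarrow> set_integrable lborel {0<..} (\<lambda>t. f (1 + t))"
    and "(LINT r:{1<..}|lborel. f r) = (LINT t:{0<..}|lborel. f (1 + t))"
proof -
  have i: "indicator {1<..} (1 + 1 * t) = (indicator {0<..} t :: real)" for t :: real
    by (auto simp: indicator_def)
  show "set_integrable lborel {1<..} f \<longleftrightarrow> set_integrable lborel {0<..} (\<lambda>t. f (1 + t))"
    unfolding set_integrable_def
    by (subst lborel_integrable_real_affine_iff[of 1 _ 1, symmetric]) (simp_all only: i, simp)
  show "(LINT r:{1<..}|lborel. f r) = (LINT t:{0<..}|lborel. f (1 + t))"
    unfolding set_lebesgue_integral_def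
    by (subst lborel_integral_real_affine[of 1 _ 1]) (simp_all only: i, simp)
qed

text \<open>On \<open>(0,1]\<close> the integrand is dominated by that of a Beta integral, beyond 1
  it is a translate of the tail above. It serves as a majorant on the axis, where the singularity at
  1 is genuine if \<open>d < 0\<close>.\<close>

lemma set_integrable_Kummer_axis:
  fixes c d l :: real
  assumes "c \<ge> 0" "d > -1" "l > c"
  shows "set_integrable lborel {0<..} (\<lambda>r. exp (- l * r) * (r powr c * \<bar>1 - r\<bar> powr d))"
proof -
  let ?f = "\<lambda>r. exp (- l * r) * (r powr c * \<bar>1 - r\<bar> powr d)"
  have "set_integrable lborel {0..1} (\<lambda>r. r powr ((c + 1) - 1) * (1 - r) powr ((d + 1) - 1))"
    by (rule integrable_Beta) (use assms in auto)
  then have "set_integrable lborel {0..1} ?f"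
    unfolding set_integrable_def
  proof (rule Bochner_Integration.integrable_bound)
    show "AE r in lborel. norm (indicator {0..1} r *\<^sub>R ?f r) \<le>
        norm (indicator {0..1} r *\<^sub>R (r powr ((c + 1) - 1) * (1 - r) powr ((d + 1) - 1)))"
      using assms by (auto simp: indicator_def intro!: mult_left_le_one_le)
  qed measurable
  then have 1: "set_integrable lborel {0<..1} ?f"
    by (rule set_integrable_subset) auto
  have "set_integrable lborel {0<..} (\<lambda>t. exp (- l) * (exp (- l * t) * ((1 + t) powr c * t powr d)))"
    using set_integrable_Kummer_tail[OF assms] by (intro set_integrable_mult_right)
  also have "?this \<longleftrightarrow> set_integrable lborel {0<..} (\<lambda>t. ?f (1 + t))"
    by (intro set_integrable_cong) (auto simp: algebra_simps exp_add exp_diff exp_minus divide_simps)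
  finally have "set_integrable lborel {1<..} ?f"
    unfolding set_integrable_shift_1 .
  with 1 have "set_integrable lborel ({0<..1} \<union> {1<..}) ?f"
    by (intro set_integrable_Un) auto
  also have "{0<..1} \<union> {1<..} = {0::real<..}" by auto
  finally show ?thesis .
qed

text \<open>Euler's integrand without the constant factor \<open>exp \<zeta>\<close>, continued by
  principal powers. In the right half plane its only cut is the real ray from 1, and
  \<open>s\<close> below that cut means \<open>1 - s\<close> above the negative axis.\<close>

definition Kummer_integrand :: "complex \<Rightarrow> real \<Rightarrow> real \<Rightarrow> complex \<Rightarrow> complex" where
  "Kummer_integrand \<zeta> c d s = exp (- (\<zeta> * s)) * s powr of_real c * (1 - s) powr of_real d"

text \<open>In the fourth quadrant both parts of \<open>s\<close> work for decay:
  \<open>Re (\<zeta> * s)\<close> is at least \<open>min (Re \<zeta>) (Im \<zeta>) * norm s\<close>,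
  which beats the growth \<open>exp (\<bar>d\<bar> * norm s)\<close> of the last factor. Rays can
  therefore be exchanged inside a cone below the real axis.\<close>

lemma Kummer_rays_eq:
  fixes \<zeta> u v :: complex and c d :: real
  assumes \<zeta>: "Re \<zeta> > \<bar>d\<bar>" "Im \<zeta> > \<bar>d\<bar>" and c: "c \<ge> 0"
    and u: "Re u > 0" "Im u < 0" and v: "Re v > 0" "Im v < 0"
  shows "(LINT r:{0<..}|lborel. u * Kummer_integrand \<zeta> c d (u * of_real r)) =
         (LINT r:{0<..}|lborel. v * Kummer_integrand \<zeta> c d (v * of_real r))"
    and "set_integrable lborel {0<..} (\<lambda>r. u * Kummer_integrand \<zeta> c d (u * of_real r))"
proof -
  \<comment> \<open>Half of the smaller slope, so that both directions lie in the open cone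
    \<open>S\<close>.\<close>
  define m where "m = min (- Im u / Re u) (- Im v / Re v) / 2"
  have m: "m > 0" using u v by (auto simp: m_def divide_neg_pos)
  define S where "S = {s. Re s > 0 \<and> Im s < - m * Re s}"
  \<comment> \<open>The solution of \<open>m * (1 - \<delta>) = \<delta>\<close>: a point within
    \<open>\<delta>\<close> of 1 would be too close to the axis to belong to the cone. This keeps
    \<open>norm (1 - s) powr d\<close> bounded when \<open>d < 0\<close>.\<close>
  define \<delta> where "\<delta> = m / (1 + m)"
  have \<delta>: "\<delta> > 0" using m by (simp add: \<delta>_def)
  define \<mu> where "\<mu> = min (Re \<zeta>) (Im \<zeta>)"
  have \<mu>: "\<mu> > \<bar>d\<bar>" using \<zeta> by (auto simp: \<mu>_def)
  have S: "S = {s. 0 < inner 1 s} \<inter> {s. inner (Complex m 1) s < 0}"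
    by (auto simp: S_def inner_complex_def algebra_simps)
  have Sm: "w \<in> S" if "Re w > 0" "2 * m \<le> - Im w / Re w" "Im w < 0" for w
  proof -
    have "2 * m * Re w \<le> - Im w" using that by (simp add: field_simps)
    moreover have "m * Re w > 0" using m that by simp
    ultimately show ?thesis using that by (simp add: S_def)
  qed
  have uv: "u \<in> S" "v \<in> S" using u v by (auto intro!: Sm simp: m_def)
  have D: "norm (1 - s) powr d \<le> (1 + \<delta> powr d) * exp (\<bar>d\<bar> * norm s)" if s: "s \<in> S" for s
  proof (cases "d \<ge> 0")
    case True
    have "norm (1 - s) powr d \<le> (1 + norm s) powr d"
      using True norm_triangle_ineq4[of 1 s] by (intro powr_mono2) auto
    also have "\<dots> \<le> exp (\<bar>d\<bar> * norm s)" by (rule powr_le_exp) auto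
    also have "\<dots> \<le> (1 + \<delta> powr d) * exp (\<bar>d\<bar> * norm s)" by (simp add: algebra_simps)
    finally show ?thesis .
  next
    case False
    have "\<delta> \<le> norm (1 - s)"
    proof (rule ccontr)
      assume n: "\<not> \<delta> \<le> norm (1 - s)"
      have "1 - Re s < \<delta>" "- Im s < \<delta>"
        using n complex_Re_le_cmod[of "1 - s"] abs_Im_le_cmod[of "1 - s"] by auto
      moreover have "m * (1 - \<delta>) = \<delta>" using m by (simp add: \<delta>_def field_simps)
      moreover have "m * (1 - Re s) < m * \<delta>" using calculation m by (intro mult_strict_left_mono)
      ultimately show False using s unfolding S_def by (simp add: algebra_simps)
    qed
    then have "norm (1 - s) powr d \<le> \<delta> powr d" using False \<delta> by (intro powr_mono2') auto
    also have "\<dots> \<le> (1 + \<delta> powr d) * exp (\<bar>d\<bar> * norm s)"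
      using mult_mono[of "\<delta> powr d" "1 + \<delta> powr d" 1 "exp (\<bar>d\<bar> * norm s)"] by simp
    finally show ?thesis .
  qed
  have pos: "Re s > 0" "Im s < 0" if "s \<in> S" for s
  proof -
    have "0 < Re s" "Im s < - m * Re s" using that by (auto simp: S_def)
    moreover from this have "0 < m * Re s" using m by simp
    ultimately show "Re s > 0" "Im s < 0" by linarith+
  qed
  have bound: "norm (Kummer_integrand \<zeta> c d s) \<le> (1 + \<delta> powr d) * norm s powr c * exp (- (\<mu> - \<bar>d\<bar>) * norm s)"
    if s: "s \<in> S" for s
  proof -
    note pos = pos[OF s]
    have "\<mu> * norm s \<le> \<mu> * (\<bar>Re s\<bar> + \<bar>Im s\<bar>)" using \<mu> cmod_le by (intro mult_left_mono) auto
    also have "\<dots> = \<mu> * Re s + \<mu> * (- Im s)" using pos by (simp add: algebra_simps)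
    also have "\<dots> \<le> Re \<zeta> * Re s + Im \<zeta> * (- Im s)"
      using pos by (intro add_mono mult_right_mono) (auto simp: \<mu>_def)
    finally have e: "norm (exp (- (\<zeta> * s))) \<le> exp (- (\<mu> * norm s))" by simp
    have "norm (Kummer_integrand \<zeta> c d s) = norm (exp (- (\<zeta> * s))) * norm s powr c * norm (1 - s) powr d"
      by (simp add: Kummer_integrand_def norm_mult norm_powr_real_powr' del: norm_exp_eq_Re)
    also have "\<dots> \<le> exp (- (\<mu> * norm s)) * norm s powr c * ((1 + \<delta> powr d) * exp (\<bar>d\<bar> * norm s))"
      using e D[OF s] by (intro mult_mono) auto
    also have "\<dots> = (1 + \<delta> powr d) * norm s powr c * exp (- (\<mu> - \<bar>d\<bar>) * norm s)"
      by (simp add: algebra_simps exp_add[symmetric] mult_exp_exp)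
    finally show ?thesis .
  qed
  have holo: "Kummer_integrand \<zeta> c d holomorphic_on S"
    unfolding Kummer_integrand_def
  proof (intro holomorphic_intros)
    fix s assume "s \<in> S"
    then have "Re s > 0" "Im s < 0" by (rule pos)+
    then show "s \<notin> \<real>\<^sub>\<le>\<^sub>0" "1 - s \<notin> \<real>\<^sub>\<le>\<^sub>0" by (auto simp: complex_nonpos_Reals_iff)
  qed
  have oS: "open S" "convex S" unfolding S
    by (auto intro!: open_Int convex_Int open_halfspace_Re_gt convex_halfspace_Re_gt open_halfspace_gt open_halfspace_lt convex_halfspace_gt convex_halfspace_lt)
  have cone: "s * of_real t \<in> S" if "s \<in> S" "t > 0" for s and t :: real
    using that mult_strict_right_mono[of "Im s" "- m * Re s" t] by (auto simp: S_def algebra_simps)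
  have S0: "0 \<notin> S" by (auto simp: S_def)
  have k: "\<mu> - \<bar>d\<bar> > 0" "c > -1" using \<mu> c by auto
  note R = integral_over_ray_eq[OF oS S0 cone holo bound k(2,1) uv]
  show "(LINT r:{0<..}|lborel. u * Kummer_integrand \<zeta> c d (u * of_real r)) =
         (LINT r:{0<..}|lborel. v * Kummer_integrand \<zeta> c d (v * of_real r))"
    "set_integrable lborel {0<..} (\<lambda>r. u * Kummer_integrand \<zeta> c d (u * of_real r))"
    by (rule R; assumption)+
qed

text \<open>Rotate a ray in the lower quadrant onto the positive real axis from below; in the limit
  \<open>(1 - s) powr d\<close> picks up the phase \<open>exp (i \<pi> d)\<close> beyond the branch point \<open>s = 1\<close>.\<close>

lemma Kummer_connection:
  fixes \<zeta> v :: complex and c d :: real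
  assumes \<zeta>: "Re \<zeta> > c + 2 * \<bar>d\<bar>" "Im \<zeta> > \<bar>d\<bar>" and c: "c \<ge> 0" and d: "d > -1"
    and v: "Re v > 0" "Im v < 0"
  shows "(LINT s:{0..1}|lborel. exp (- (\<zeta> * of_real s)) * of_real (s powr c * (1 - s) powr d)) +
      exp (\<i> * pi * d) * (LINT s:{1<..}|lborel. exp (- (\<zeta> * of_real s)) * of_real (s powr c * (s - 1) powr d)) =
      (LINT r:{0<..}|lborel. v * Kummer_integrand \<zeta> c d (v * of_real r))"
proof -
  let ?Q = "LINT r:{0<..}|lborel. v * Kummer_integrand \<zeta> c d (v * of_real r)"
  \<comment> \<open>\<open>H\<close> is the boundary value of the integrand on the axis from below,
    the limit along the directions \<open>u n\<close> whose slope tends to 0.\<close>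
  define H where "H r = exp (- (\<zeta> * of_real r)) * of_real (r powr c * \<bar>1 - r\<bar> powr d) *
    (if r < 1 then 1 else exp (\<i> * pi * d))" for r :: real
  define u where "u n = Complex 1 (- 1 / (real n + 1))" for n :: nat
  \<comment> \<open>A majorant for all \<open>n\<close> at once. The factors 2 come from
    \<open>norm (u n) \<le> 2\<close>, as does the doubled \<open>\<bar>d\<bar>\<close>. The first
    summand controls the growth for \<open>d \<ge> 0\<close>, the second the singularity at 1 for
    \<open>d < 0\<close>.\<close>
  define W where "W r = 2 * (2 powr c) * (r powr c * exp (- (Re \<zeta> - 2 * \<bar>d\<bar>) * r) +
      exp (- Re \<zeta> * r) * (r powr c * \<bar>1 - r\<bar> powr d))" for r
  have z: "Re \<zeta> > \<bar>d\<bar>" "Im \<zeta> > \<bar>d\<bar>" "Re \<zeta> > 0" "Im \<zeta> > 0" using \<zeta> c by auto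

  have u: "Re (u n) > 0" "Im (u n) < 0" for n by (auto simp: u_def divide_neg_pos)
  have nu: "norm (u n) \<le> 2" for n
  proof -
    have "norm (u n) \<le> \<bar>Re (u n)\<bar> + \<bar>Im (u n)\<bar>" by (rule cmod_le)
    also have "\<dots> \<le> 2" by (simp add: u_def)
    finally show ?thesis .
  qed
  note R = Kummer_rays_eq[OF z(1,2) c]
  let ?s = "\<lambda>n r. indicator {0<..} r *\<^sub>R (u n * Kummer_integrand \<zeta> c d (u n * of_real r))"
  have eqQ: "integral\<^sup>L lborel (?s n) = ?Q" for n
    using R(1)[OF u[of n] v] unfolding set_lebesgue_integral_def .
  have sW: "set_integrable lborel {0<..} W"
    unfolding W_def using \<zeta> c d
    by (intro set_integrable_mult_right set_integral_add set_integrable_Gamma_kernel set_integrable_Kummer_axis) auto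
  have bnd: "norm (u n * Kummer_integrand \<zeta> c d (u n * of_real r)) \<le> W r" if r: "r > 0" "r \<noteq> 1" for n r
  proof -
    define s where "s = u n * of_real r"
    have rs: "Re s = r" "Im s \<le> 0" using r by (auto simp: s_def u_def divide_nonneg_pos)
    have ns: "norm s \<le> 2 * r" using nu[of n] r by (simp add: s_def norm_mult mult_right_mono)
    have "norm (exp (- (\<zeta> * s))) \<le> exp (- Re \<zeta> * r)"
      using rs z mult_nonneg_nonpos[of "Im \<zeta>" "Im s"] by simp
    moreover have "norm s powr c \<le> 2 powr c * r powr c"
      using powr_mono2[OF c _ ns] r by (simp add: powr_mult)
    moreover have "norm (1 - s) powr d \<le> exp (2 * \<bar>d\<bar> * r) + \<bar>1 - r\<bar> powr d"
    proof (cases "d \<ge> 0")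
      case True
      have "norm (1 - s) \<le> 1 + 2 * r" using norm_triangle_ineq4[of 1 s] ns by simp
      then have "norm (1 - s) powr d \<le> (1 + 2 * r) powr d" using True by (intro powr_mono2) auto
      also have "\<dots> \<le> exp (\<bar>d\<bar> * (2 * r))" using r by (intro powr_le_exp) auto
      finally show ?thesis by (simp add: mult_ac add_increasing2)
    next
      case False
      have "\<bar>1 - r\<bar> \<le> norm (1 - s)" using abs_Re_le_cmod[of "1 - s"] rs by simp
      then have "norm (1 - s) powr d \<le> \<bar>1 - r\<bar> powr d"
        using False r by (intro powr_mono2') auto
      then show ?thesis by (simp add: add_increasing)
    qed
    moreover have "norm (u n * Kummer_integrand \<zeta> c d s) =
        norm (u n) * (norm (exp (- (\<zeta> * s))) * norm s powr c * norm (1 - s) powr d)"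
      by (simp add: Kummer_integrand_def norm_mult norm_powr_real_powr' del: norm_exp_eq_Re)
    ultimately have "norm (u n * Kummer_integrand \<zeta> c d s) \<le>
        2 * (exp (- Re \<zeta> * r) * (2 powr c * r powr c) * (exp (2 * \<bar>d\<bar> * r) + \<bar>1 - r\<bar> powr d))"
      using nu[of n] by (auto intro!: mult_mono)
    also have "\<dots> = W r"
    proof -
      have "exp (- (Re \<zeta> - 2 * \<bar>d\<bar>) * r) = exp (- Re \<zeta> * r) * exp (2 * \<bar>d\<bar> * r)"
        by (simp add: exp_add[symmetric] algebra_simps)
      then show ?thesis unfolding W_def by (simp only: distrib_left mult_ac)
    qed
    finally show ?thesis by (simp add: s_def)
  qed
  have lim: "(\<lambda>n. u n * Kummer_integrand \<zeta> c d (u n * of_real r)) \<longlonglongrightarrow> H r" if r: "r > 0" "r \<noteq> 1" for r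
  proof -
    have "(\<lambda>n. - 1 / (real n + 1)) \<longlonglongrightarrow> 0" by real_asymp
    then have "u \<longlonglongrightarrow> Complex 1 0"
      unfolding u_def by (intro tendsto_Complex tendsto_const)
    then have u1: "u \<longlonglongrightarrow> 1" by (simp add: one_complex.code)
    then have ur: "(\<lambda>n. u n * of_real r) \<longlonglongrightarrow> of_real r"
      using tendsto_mult[OF u1 tendsto_const[of "of_real r"]] by simp
    have A: "(\<lambda>n. (u n * of_real r) powr of_real c) \<longlonglongrightarrow> of_real (r powr c)"
      using tendsto_powr_complex[OF _ ur tendsto_const[of "of_real c"]] r
      by (simp add: powr_of_real complex_nonpos_Reals_iff)
    have B: "(\<lambda>n. (1 - u n * of_real r) powr of_real d) \<longlonglongrightarrow>
        of_real (\<bar>1 - r\<bar> powr d) * (if r < 1 then 1 else exp (\<i> * pi * d))"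
    proof (cases "r < 1")
      case True
      have "(\<lambda>n. (1 - u n * of_real r) powr of_real d) \<longlonglongrightarrow> (1 - of_real r) powr of_real d"
        using True by (intro tendsto_powr_complex tendsto_intros ur) (auto simp: complex_nonpos_Reals_iff)
      also have "(1 - of_real r) powr of_real d = complex_of_real (\<bar>1 - r\<bar> powr d)"
        using True powr_of_real[of "1 - r" d] by simp
      finally show ?thesis using True by simp
    next
      case False
      have "(\<lambda>n. (1 - u n * of_real r) powr of_real d) \<longlonglongrightarrow> of_real ((r - 1) powr d) * exp (\<i> * pi * d)"
      proof (rule tendsto_powr_negative_real_from_above)
        show "(\<lambda>n. 1 - u n * of_real r) \<longlonglongrightarrow> - of_real (r - 1)"
          using tendsto_diff[OF tendsto_const[of 1] ur] by simp
        show "Im (1 - u n * of_real r) > 0" for n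
          using r by (simp add: u_def)
      qed (use False r in auto)
      then show ?thesis using False by simp
    qed
    have "(\<lambda>n. u n * (exp (- (\<zeta> * (u n * of_real r))) * (u n * of_real r) powr of_real c *
        (1 - u n * of_real r) powr of_real d)) \<longlonglongrightarrow>
        1 * (exp (- (\<zeta> * of_real r)) * of_real (r powr c) *
          (of_real (\<bar>1 - r\<bar> powr d) * (if r < 1 then 1 else exp (\<i> * pi * d))))"
      by (intro tendsto_mult u1 tendsto_exp tendsto_minus tendsto_const ur A B)
    then show ?thesis by (simp add: H_def Kummer_integrand_def mult_ac)
  qed
  have HW: "norm (H r) \<le> W r" if "r > 0" "r \<noteq> 1" for r
    by (rule LIMSEQ_le_const2[OF tendsto_norm[OF lim[OF that]]]) (use bnd that in auto)
  have Hm [measurable]: "H \<in> borel_measurable borel"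
    unfolding H_def by measurable
  have n1: "AE r in lborel. r \<noteq> (1::real)" by (rule AE_lborel_singleton)
  \<comment> \<open>By independence of the ray this sequence is constantly \<open>?Q\<close>, so
    dominated convergence identifies \<open>?Q\<close> with the integral of
    \<open>H\<close>.\<close>
  have "(\<lambda>n. integral\<^sup>L lborel (?s n)) \<longlonglongrightarrow> (LINT r|lborel. indicator {0<..} r *\<^sub>R H r)"
  proof (rule integral_dominated_convergence)
    show "integrable lborel (\<lambda>r. indicator {0<..} r *\<^sub>R W r)" using sW unfolding set_integrable_def .
    show "?s n \<in> borel_measurable lborel" for n
      using R(2)[OF u[of n] v] unfolding set_integrable_def by (rule borel_measurable_integrable)
    show "AE r in lborel. (\<lambda>n. ?s n r) \<longlonglongrightarrow> indicator {0<..} r *\<^sub>R H r"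
      using n1 by eventually_elim (auto simp: indicator_def intro: lim)
    show "AE r in lborel. norm (?s n r) \<le> indicator {0<..} r *\<^sub>R W r" for n
      using n1 by eventually_elim (auto simp: indicator_def intro: bnd)
  qed simp
  then have "(LINT r:{0<..}|lborel. H r) = ?Q"
    unfolding eqQ by (simp add: LIMSEQ_const_iff set_lebesgue_integral_def)
  moreover have sH: "set_integrable lborel {0<..} H"
    unfolding set_integrable_def
  proof (rule Bochner_Integration.integrable_bound)
    show "integrable lborel (\<lambda>r. indicator {0<..} r *\<^sub>R W r)" using sW unfolding set_integrable_def .
    show "AE r in lborel. norm (indicator {0<..} r *\<^sub>R H r) \<le> norm (indicator {0<..} r *\<^sub>R W r)"
      using n1 by eventually_elim (auto simp: indicator_def intro: HW order_trans[OF _ abs_ge_self])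
  qed simp
  moreover have "(LINT r:{0<..}|lborel. H r) = (LINT r:{0<..1}|lborel. H r) + (LINT r:{1<..}|lborel. H r)"
  proof -
    have "{0<..} = {0<..1} \<union> {1::real<..}" by auto
    then have "(LINT r:{0<..}|lborel. H r) = (LINT r:({0<..1} \<union> {1<..})|lborel. H r)" by simp
    also have "\<dots> = (LINT r:{0<..1}|lborel. H r) + (LINT r:{1<..}|lborel. H r)"
      by (rule set_integral_Un) (auto intro: set_integrable_subset[OF sH])
    finally show ?thesis .
  qed
  moreover have "(LINT r:{0<..1}|lborel. H r) =
      (LINT s:{0..1}|lborel. exp (- (\<zeta> * of_real s)) * of_real (s powr c * (1 - s) powr d))"
    unfolding set_lebesgue_integral_def
    by (rule integral_cong_AE)
       (use n1 AE_lborel_singleton[of "0::real"] in \<open>auto simp: H_def indicator_def elim!: eventually_rev_mp\<close>)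
  moreover have "(LINT r:{1<..}|lborel. H r) =
      exp (\<i> * pi * d) * (LINT s:{1<..}|lborel. exp (- (\<zeta> * of_real s)) * of_real (s powr c * (s - 1) powr d))"
    by (subst set_integral_mult_right[symmetric], rule set_lebesgue_integral_cong)
       (auto simp: H_def mult_ac)
  ultimately show ?thesis by simp
qed

section \<open>Asymptotics of the two terms\<close>

text \<open>From \<open>ln x \<le> x - 1\<close> at \<open>x = t / s\<close> the difference of
  logarithms is at most \<open>(t - s) / s\<close>, and this is at most \<open>t - s\<close> because
  \<open>(t - s) * (s - 1) \<ge> 0\<close> in both cases. Thus \<open>ln t - t\<close> falls off
  monotonically on either side of 1.\<close>

lemma ln_le_secant:
  fixes s t :: real
  assumes "0 < t" "0 < s" "(s \<le> t \<and> 1 \<le> s) \<or> (t \<le> s \<and> s \<le> 1)"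
  shows "ln t - t \<le> ln s - s"
proof -
  have "ln (t / s) \<le> t / s - 1" using assms by (intro ln_le_minus_one) auto
  then have "ln t - ln s \<le> (t - s) / s" using assms by (simp add: ln_div field_simps)
  also have "\<dots> \<le> t - s" using assms mult_nonneg_nonneg[of "t - s" "s - 1"] mult_nonneg_nonneg[of "s - t" "1 - s"]
    by (auto simp: field_simps)
  finally show ?thesis by simp
qed

lemma powr_times_exp_eq:
  fixes t c :: real
  assumes "t > 0"
  shows "t powr c * exp (- c * t) = exp (c * (ln t - t))"
  using assms by (simp add: powr_def exp_add[symmetric] algebra_simps)

text \<open>The kernel is \<open>exp (c * (ln t - t))\<close>, with peak value
  \<open>exp (- c)\<close> at 1. The upper bound is \<open>ln t \<le> t - 1\<close>; the lower bound
  compares a small window around 1 with the rest. Only the exponential rate is extracted, not the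
  width of the peak.\<close>

lemma Laplace_at_1:
  fixes g :: "real \<Rightarrow> complex" and \<kappa> :: real
  defines "P \<equiv> \<lambda>c. LINT t:{0<..}|lborel. of_real (t powr c * exp (- c * t)) * g t"
  assumes g: "continuous_on {0<..} g" "set_integrable lborel {0<..} g"
  shows "\<exists>C. \<forall>c\<ge>0. norm (P c) \<le> C * exp (- c)"
    and "g 1 \<noteq> 0 \<Longrightarrow> \<kappa> > 0 \<Longrightarrow> \<forall>\<^sub>F c in at_top. norm (P c) \<ge> exp (- (1 + \<kappa>) * c)"
proof -
  have ng: "set_integrable lborel {0<..} (\<lambda>t. norm (g t))" using g(2) by (rule set_integrable_norm)
  have rho: "t powr c * exp (- c * t) \<le> exp (- c)" if "t > 0" "c \<ge> 0" for t c :: real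
    unfolding powr_times_exp_eq[OF that(1)]
    using mult_left_mono[OF ln_le_minus_one[OF that(1)] that(2)] by (simp add: algebra_simps)
  have b: "norm (of_real (t powr c * exp (- c * t)) * g t) \<le> exp (- c) * norm (g t)" if "t > 0" "c \<ge> 0" for t c
    using rho[OF that] that by (auto simp: norm_mult abs_mult intro!: mult_right_mono)
  have ig: "set_integrable lborel {0<..} (\<lambda>t. of_real (t powr c * exp (- c * t)) * g t)" if "c \<ge> 0" for c
  proof (rule set_integrable_bound_continuous)
    show "set_integrable lborel {0<..} (\<lambda>t. exp (- c) * norm (g t))"
      using ng by (intro set_integrable_mult_right)
  qed (use b that in \<open>auto intro!: continuous_intros g\<close>)

  show "\<exists>C. \<forall>c\<ge>0. norm (P c) \<le> C * exp (- c)"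
  proof (intro exI allI impI)
    fix c :: real assume c: "c \<ge> 0"
    have "norm (P c) \<le> (LINT t:{0<..}|lborel. exp (- c) * norm (g t))"
      unfolding P_def
    proof (rule order_trans[OF set_integral_norm_bound[OF ig[OF c]] set_integral_mono])
      show "set_integrable lborel {0<..} (\<lambda>t. norm (of_real (t powr c * exp (- c * t)) * g t))"
        using ig[OF c] by (rule set_integrable_norm)
      show "set_integrable lborel {0<..} (\<lambda>t. exp (- c) * norm (g t))"
        using ng by (intro set_integrable_mult_right)
    qed (use b c in auto)
    then show "norm (P c) \<le> (LINT t:{0<..}|lborel. norm (g t)) * exp (- c)" by (simp add: mult_ac)
  qed
  assume g1: "g 1 \<noteq> 0" and \<kappa>: "\<kappa> > 0"
  \<comment> \<open>The factor \<open>cnj (g 1)\<close> turns the value of \<open>g\<close> at 1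
    into a positive real, so that real parts near the peak cannot cancel.\<close>
  define h where "h t = Re (cnj (g 1) * g t)" for t
  define \<eta> where "\<eta> = h 1 / 2"
  have h1: "h 1 = (norm (g 1))\<^sup>2" unfolding h_def cmod_power2 by (simp add: power2_eq_square)
  then have \<eta>: "\<eta> > 0" using g1 by (simp add: \<eta>_def)
  have "isCont h 1"
  proof -
    have "isCont g 1" using g(1) by (simp add: continuous_on_eq_continuous_at)
    then show ?thesis unfolding h_def by (intro continuous_Re continuous_intros)
  qed
  then have "\<forall>\<^sub>F t in nhds 1. h t > \<eta>"
    using \<eta> by (intro order_tendstoD) (auto simp: \<eta>_def isCont_def tendsto_at_iff_tendsto_nhds)
  then obtain \<delta>' where \<delta>': "\<delta>' > 0" "\<And>t. \<bar>t - 1\<bar> < \<delta>' \<Longrightarrow> h t > \<eta>"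
    by (auto simp: eventually_nhds_metric dist_real_def)
  define \<delta> where "\<delta> = min \<delta>' 1 / 2"
  have \<delta>: "0 < \<delta>" "\<delta> < 1" "\<delta> < \<delta>'" using \<delta>' by (auto simp: \<delta>_def)
  \<comment> \<open>The amount by which \<open>ln t - t\<close> has dropped below its maximum -1 at
    \<open>1 + \<delta>\<close> and at \<open>1 - \<delta>\<close>, whichever is smaller.\<close>
  define \<theta> where "\<theta> = min (\<delta> - ln (1 + \<delta>)) (- ln (1 - \<delta>) - \<delta>)"
  have \<theta>: "\<theta> > 0"
  proof -
    have "ln (1 - \<delta>) \<noteq> - \<delta>" using \<delta> ln_eq_minus_one[of "1 - \<delta>"] by auto
    then have "ln (1 - \<delta>) < - \<delta>" using ln_one_minus_pos_upper_bound[of \<delta>] \<delta> by (simp add: less_le)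
    then show ?thesis using \<delta> ln_add_one_self_less_self[of \<delta>] by (simp add: \<theta>_def)
  qed
  have off: "ln t - t \<le> - 1 - \<theta>" if "t > 0" "\<bar>t - 1\<bar> \<ge> \<delta>" for t
    using that \<delta> ln_le_secant[of t "1 + \<delta>"] ln_le_secant[of t "1 - \<delta>"]
    by (auto simp: \<theta>_def abs_if min_def split: if_splits)
  \<comment> \<open>On a window of radius \<open>\<delta>1\<close> the drop is less than
    \<open>\<theta>'\<close>. Since \<open>\<theta>'\<close> is below both \<open>\<theta>\<close>
    and \<open>\<kappa>\<close>, the window beats the contribution away from the peak as well as the
    target rate.\<close>
  define \<theta>' where "\<theta>' = min \<theta> \<kappa> / 2"
  have \<theta>': "0 < \<theta>'" "\<theta>' < \<theta>" "\<theta>' < \<kappa>" using \<theta> \<kappa> by (auto simp: \<theta>'_def)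
  have "((\<lambda>t. ln t - t) \<longlongrightarrow> ln 1 - 1) (nhds (1::real))"
    by (intro tendsto_intros filterlim_ident) auto
  then have "\<forall>\<^sub>F t in nhds 1. ln t - t > - 1 - \<theta>'"
    by (rule order_tendstoD) (use \<theta>' in auto)
  then obtain \<delta>1' where \<delta>1': "\<delta>1' > 0" "\<And>t. \<bar>t - 1\<bar> < \<delta>1' \<Longrightarrow> ln t - t > - 1 - \<theta>'"
    by (auto simp: eventually_nhds_metric dist_real_def)
  define \<delta>1 where "\<delta>1 = min (\<delta> / 2) (\<delta>1' / 2)"
  have \<delta>1: "0 < \<delta>1" "\<delta>1 < \<delta>" "\<delta>1 < \<delta>1'" using \<delta>1' \<delta> by (auto simp: \<delta>1_def)
  define I where "I = (LINT t:{0<..}|lborel. norm (g 1) * norm (g t))"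
  have lower: "norm (g 1) * norm (P c) \<ge> 2 * \<delta>1 * \<eta> * exp (- (1 + \<theta>') * c) - exp (- (1 + \<theta>) * c) * I"
    if c: "c \<ge> 0" for c
  proof -
    let ?r = "\<lambda>t. t powr c * exp (- c * t)"
    \<comment> \<open>Three zones: the window gives the main term, between \<open>\<delta>1\<close>
      and \<open>\<delta>\<close> positivity of \<open>h\<close> suffices, and beyond
      \<open>\<delta>\<close> the kernel is small. The error is subtracted everywhere, so that it
      integrates to a multiple of \<open>I\<close>.\<close>
    have pt: "?r t * h t \<ge> \<eta> * exp (- (1 + \<theta>') * c) * indicator {1 - \<delta>1..1 + \<delta>1} t
        - exp (- (1 + \<theta>) * c) * (norm (g 1) * norm (g t))" if t: "t > 0" for t
    proof (cases "\<bar>t - 1\<bar> < \<delta>")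
      case True
      then have ht: "h t > \<eta>" using \<delta> \<delta>' by auto
      show ?thesis
      proof (cases "t \<in> {1 - \<delta>1..1 + \<delta>1}")
        case in1: True
        then have "ln t - t > - 1 - \<theta>'" using \<delta>1 by (intro \<delta>1') (auto simp: abs_if)
        then have "c * (- 1 - \<theta>') \<le> c * (ln t - t)" using c by (intro mult_left_mono) auto
        then have "exp (- (1 + \<theta>') * c) \<le> ?r t"
          unfolding powr_times_exp_eq[OF t] by (simp add: algebra_simps)
        then have "\<eta> * exp (- (1 + \<theta>') * c) \<le> h t * ?r t" using ht \<eta> by (intro mult_mono) auto
        also have "\<dots> = ?r t * h t" by (rule mult.commute)
        finally have "\<eta> * exp (- (1 + \<theta>') * c) \<le> ?r t * h t" .
        moreover have "0 \<le> exp (- (1 + \<theta>) * c) * (norm (g 1) * norm (g t))" by simp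
        moreover have "indicator {1 - \<delta>1..1 + \<delta>1} t = (1::real)" using in1 by simp
        ultimately show ?thesis by (simp only: mult_1_right)
      next
        case False
        have "0 \<le> ?r t * h t" using ht \<eta> by simp
        moreover have "0 \<le> exp (- (1 + \<theta>) * c) * (norm (g 1) * norm (g t))" by simp
        moreover have "indicator {1 - \<delta>1..1 + \<delta>1} t = (0::real)" using False by simp
        ultimately show ?thesis by (simp only: mult_zero_right, linarith?)
      qed
    next
      case False
      then have "c * (ln t - t) \<le> c * (- 1 - \<theta>)" using off[of t] t c by (intro mult_left_mono) auto
      then have r: "?r t \<le> exp (- (1 + \<theta>) * c)"
        unfolding powr_times_exp_eq[OF t] by (simp add: algebra_simps)
      have "\<bar>h t\<bar> \<le> norm (g 1) * norm (g t)"
        unfolding h_def using abs_Re_le_cmod[of "cnj (g 1) * g t"] by (simp add: norm_mult)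
      then have "?r t * \<bar>h t\<bar> \<le> exp (- (1 + \<theta>) * c) * (norm (g 1) * norm (g t))"
        using r by (intro mult_mono) auto
      moreover have "?r t * h t \<ge> - (?r t * \<bar>h t\<bar>)"
        using mult_left_mono[of "- \<bar>h t\<bar>" "h t" "?r t"] by auto
      moreover have "t \<notin> {1 - \<delta>1..1 + \<delta>1}" using False \<delta>1 by (auto simp: abs_if split: if_splits)
      then have "indicator {1 - \<delta>1..1 + \<delta>1} t = (0::real)" by simp
      ultimately show ?thesis by (simp only: mult_zero_right, linarith?)
    qed
    have i2: "set_integrable lborel {0<..} (\<lambda>t. exp (- (1 + \<theta>) * c) * (norm (g 1) * norm (g t)))"
      by (intro set_integrable_mult_right ng)

    have hb: "has_bochner_integral lborel
        (\<lambda>t. indicator {0<..} t *\<^sub>R (\<eta> * exp (- (1 + \<theta>') * c) * indicator {1 - \<delta>1..1 + \<delta>1} t))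
        (\<eta> * exp (- (1 + \<theta>') * c) * (2 * \<delta>1))"
    proof -
      have "has_bochner_integral lborel (indicator {1 - \<delta>1..1 + \<delta>1} :: real \<Rightarrow> real) (2 * \<delta>1)"
        using has_bochner_integral_real_indicator[of "{1 - \<delta>1..1 + \<delta>1}" lborel] \<delta>1 by simp
      note has_bochner_integral_mult_right[OF this, of "\<eta> * exp (- (1 + \<theta>') * c)"]
      moreover have "(\<lambda>t. indicator {0<..} t *\<^sub>R (\<eta> * exp (- (1 + \<theta>') * c) * indicator {1 - \<delta>1..1 + \<delta>1} t))
          = (\<lambda>t. \<eta> * exp (- (1 + \<theta>') * c) * indicator {1 - \<delta>1..1 + \<delta>1} t)"
        using \<delta>1 \<delta> by (auto simp: indicator_def)
      ultimately show ?thesis by (simp only:)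
    qed
    then have i1: "set_integrable lborel {0<..} (\<lambda>t. \<eta> * exp (- (1 + \<theta>') * c) * indicator {1 - \<delta>1..1 + \<delta>1} t)"
      and v1: "(LINT t:{0<..}|lborel. \<eta> * exp (- (1 + \<theta>') * c) * indicator {1 - \<delta>1..1 + \<delta>1} t)
        = \<eta> * exp (- (1 + \<theta>') * c) * (2 * \<delta>1)"
      unfolding has_bochner_integral_iff set_integrable_def set_lebesgue_integral_def by blast+
    have ic: "set_integrable lborel {0<..} (\<lambda>t. cnj (g 1) * (of_real (?r t) * g t))"
      using ig[OF c] by (intro set_integrable_mult_right)
    have Re: "(\<lambda>t. Re (indicator {0<..} t *\<^sub>R (cnj (g 1) * (of_real (?r t) * g t))))
        = (\<lambda>t. indicator {0<..} t *\<^sub>R (?r t * h t))"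
      by (auto simp: fun_eq_iff indicator_def h_def algebra_simps)
    have i3: "set_integrable lborel {0<..} (\<lambda>t. ?r t * h t)"
      using integrable_Re[OF ic[unfolded set_integrable_def]] unfolding set_integrable_def Re .
    have v3: "(LINT t:{0<..}|lborel. ?r t * h t) = Re (cnj (g 1) * P c)"
    proof -
      have "Re (cnj (g 1) * P c) = Re (LINT t:{0<..}|lborel. cnj (g 1) * (of_real (?r t) * g t))"
        unfolding P_def by (subst set_integral_mult_right) simp
      also have "\<dots> = (LINT t:{0<..}|lborel. ?r t * h t)"
        unfolding set_lebesgue_integral_def integral_Re[OF ic[unfolded set_integrable_def], symmetric] Re ..
      finally show ?thesis by simp
    qed
    have "2 * \<delta>1 * \<eta> * exp (- (1 + \<theta>') * c) - exp (- (1 + \<theta>) * c) * I =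
      (LINT t:{0<..}|lborel. \<eta> * exp (- (1 + \<theta>') * c) * indicator {1 - \<delta>1..1 + \<delta>1} t
        - exp (- (1 + \<theta>) * c) * (norm (g 1) * norm (g t)))"
      unfolding set_integral_diff(2)[OF i1 i2] v1 I_def by (simp add: set_integral_mult_right mult_ac)
    also have "\<dots> \<le> (LINT t:{0<..}|lborel. ?r t * h t)"
      using i3 i1 i2 pt by (intro set_integral_mono set_integral_diff) auto
    also have "\<dots> = Re (cnj (g 1) * P c)"
      by (rule v3)
    also have "\<dots> \<le> norm (g 1) * norm (P c)"
      using complex_Re_le_cmod[of "cnj (g 1) * P c"] by (simp add: norm_mult)
    finally show ?thesis .
  qed
  have "\<forall>\<^sub>F c in at_top. norm (g 1) * exp (- (1 + \<kappa>) * c) \<le>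
      2 * \<delta>1 * \<eta> * exp (- (1 + \<theta>') * c) - exp (- (1 + \<theta>) * c) * I"
  proof -
    have e: "((\<lambda>c. exp (- k * c)) \<longlongrightarrow> 0) at_top" if "k > 0" for k :: real
      using that by real_asymp
    have "((\<lambda>c. norm (g 1) * exp (- (\<kappa> - \<theta>') * c) + exp (- (\<theta> - \<theta>') * c) * I)
        \<longlongrightarrow> norm (g 1) * 0 + 0 * I) at_top"
      using \<theta>' by (intro tendsto_intros e) auto
    then have "\<forall>\<^sub>F c in at_top. norm (g 1) * exp (- (\<kappa> - \<theta>') * c) + exp (- (\<theta> - \<theta>') * c) * I < 2 * \<delta>1 * \<eta>"
      using \<delta>1 \<eta> by (intro order_tendstoD) auto
    then show ?thesis
    proof eventually_elim
      case (elim c)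
      have s: "exp (- (k - \<theta>') * c) * exp (- (1 + \<theta>') * c) = exp (- (1 + k) * c)" for k
        by (simp add: exp_add[symmetric] algebra_simps)
      have "(norm (g 1) * exp (- (\<kappa> - \<theta>') * c) + exp (- (\<theta> - \<theta>') * c) * I) * exp (- (1 + \<theta>') * c)
          \<le> 2 * \<delta>1 * \<eta> * exp (- (1 + \<theta>') * c)"
        using elim by (intro mult_right_mono) auto
      also have "(norm (g 1) * exp (- (\<kappa> - \<theta>') * c) + exp (- (\<theta> - \<theta>') * c) * I) * exp (- (1 + \<theta>') * c)
          = norm (g 1) * (exp (- (\<kappa> - \<theta>') * c) * exp (- (1 + \<theta>') * c))
            + (exp (- (\<theta> - \<theta>') * c) * exp (- (1 + \<theta>') * c)) * I"
        by (simp only: distrib_left distrib_right mult_ac)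
      finally show ?case unfolding s by linarith
    qed
  qed
  then show "\<forall>\<^sub>F c in at_top. norm (P c) \<ge> exp (- (1 + \<kappa>) * c)"
    using eventually_ge_at_top[of 0]
  proof eventually_elim
    case (elim c)
    then have "norm (g 1) * exp (- (1 + \<kappa>) * c) \<le> norm (g 1) * norm (P c)"
      using lower[of c] by simp
    then show ?case using g1 by simp
  qed
qed

section \<open>The endpoint contribution at s = 1\<close>

text \<open>Rotating the ray through \<open>p\<close> onto the positive axis evaluates the integral
  as Gamma(a) p^(-a), and Gamma has no zeros.\<close>

lemma exponential_ray_integral_nonzero:
  fixes p :: complex and a :: real
  assumes a: "a > 0" and p: "Re p > 0"
  shows "(LINT v:{0<..}|lborel. exp (- (p * of_real v)) * of_real (v powr (a - 1))) \<noteq> 0"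
proof
  assume L0: "(LINT v:{0<..}|lborel. exp (- (p * of_real v)) * of_real (v powr (a - 1))) = 0"
  define G where "G s = exp (- s) * s powr of_real (a - 1)" for s :: complex
  \<comment> \<open>Chosen so that the cone \<open>m * norm s < Re s\<close> contains both 1 and
    \<open>p\<close>; on it \<open>exp (- s)\<close> decays at rate \<open>m\<close>.\<close>
  define m where "m = min 1 (Re p / norm p) / 2"
  have np: "norm p > 0" using p by auto
  have m: "m > 0" "m < 1" "m * norm p < Re p"
  proof -
    show "m > 0" using p np by (simp add: m_def)
    show "m < 1" by (simp add: m_def min_def)
    have "min 1 q / 2 < q" if "q > 0" for q :: real using that by (auto simp: min_def)
    from this[of "Re p / norm p"] have "m < Re p / norm p" using divide_pos_pos[OF p np] unfolding m_def .
    then show "m * norm p < Re p" using np by (simp add: field_simps)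
  qed
  define S where "S = {s. m * norm s < Re s}"
  have S: "Re s > 0" if "s \<in> S" for s
  proof -
    have "0 \<le> m * norm s" using m by simp
    also have "\<dots> < Re s" using that by (simp add: S_def)
    finally show ?thesis .
  qed
  have "open S" unfolding S_def by (intro open_Collect_less continuous_intros)
  moreover have "convex S"
  proof (rule convexI)
    fix x y :: complex and u v :: real
    assume *: "x \<in> S" "y \<in> S" "0 \<le> u" "0 \<le> v" "u + v = 1"
    have "m * norm (u *\<^sub>R x + v *\<^sub>R y) \<le> m * (u * norm x + v * norm y)"
      using m(1) norm_triangle_ineq[of "u *\<^sub>R x" "v *\<^sub>R y"] * by (intro mult_left_mono) auto
    also have "\<dots> = u * (m * norm x) + v * (m * norm y)" by (simp add: algebra_simps)
    also have "\<dots> < u * Re x + v * Re y"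
    proof (cases "u = 0")
      case True
      then show ?thesis using * by (simp add: S_def)
    next
      case False
      then have "u * (m * norm x) < u * Re x" "v * (m * norm y) \<le> v * Re y"
        using * by (auto simp: S_def intro!: mult_left_mono mult_strict_left_mono)
      then show ?thesis by simp
    qed
    finally show "u *\<^sub>R x + v *\<^sub>R y \<in> S" by (simp add: S_def)
  qed
  moreover have "0 \<notin> S" by (simp add: S_def)
  moreover have "s * of_real t \<in> S" if "s \<in> S" "t > 0" for s and t :: real
    using that mult_strict_right_mono[of "m * norm s" "Re s" t] by (simp add: S_def norm_mult mult_ac)
  moreover have "G holomorphic_on S"
    unfolding G_def by (intro holomorphic_intros) (auto simp: complex_nonpos_Reals_iff dest: S)
  moreover have "norm (G s) \<le> 1 * norm s powr (a - 1) * exp (- m * norm s)" if "s \<in> S" for s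
    using that by (auto simp: G_def S_def norm_mult norm_powr_real_powr' mult.commute intro!: mult_right_mono)
  moreover have "a - 1 > -1" "1 \<in> S" "p \<in> S" using a m by (auto simp: S_def)
  ultimately have eq: "(LINT r:{0<..}|lborel. 1 * G (1 * of_real r)) = (LINT r:{0<..}|lborel. p * G (p * of_real r))"
    by (intro integral_over_ray_eq(2)[where S = S and C = 1 and q = "a - 1" and c = m]) (use m in auto)
  have pr: "complex_of_real r powr (of_real a - 1) = of_real (r powr (a - 1))" if "r > 0" for r
    using powr_of_real[of r "a - 1"] that by simp
  have "(LINT r:{0<..}|lborel. 1 * G (1 * of_real r)) = (LINT r:{0<..}|lborel. complex_of_real (r powr (a - 1) * exp (- r)))"
    by (rule set_lebesgue_integral_cong) (auto simp: G_def pr exp_of_real mult_ac simp flip: of_real_minus)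
  also have "\<dots> = of_real (Gamma a)"
    using set_lebesgue_integral_Gamma[of "a - 1"] a by (simp add: set_integral_complex_of_real del: of_real_mult)
  finally have "(LINT r:{0<..}|lborel. p * G (p * of_real r)) = of_real (Gamma a)" using eq by simp
  moreover have "(LINT r:{0<..}|lborel. p * G (p * of_real r)) =
     (LINT r:{0<..}|lborel. (p * p powr of_real (a - 1)) * (exp (- (p * of_real r)) * of_real (r powr (a - 1))))"
  proof (rule set_lebesgue_integral_cong)
    show "\<forall>r. r \<in> {0<..} \<longrightarrow> p * G (p * of_real r) =
        (p * p powr of_real (a - 1)) * (exp (- (p * of_real r)) * of_real (r powr (a - 1)))"
    proof (intro allI impI)
      fix r :: real assume "r \<in> {0<..}"
      then have "(p * of_real r) powr of_real (a - 1) = p powr of_real (a - 1) * of_real (r powr (a - 1))"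
        using powr_times_real_left[of "of_real r" p "of_real (a - 1)"] pr[of r] by (simp add: mult.commute)
      then show "p * G (p * of_real r) =
          (p * p powr of_real (a - 1)) * (exp (- (p * of_real r)) * of_real (r powr (a - 1)))"
        by (simp only: G_def mult_ac)
    qed
  qed auto
  ultimately have "complex_of_real (Gamma a) = 0"
    using L0 by (simp only: set_integral_mult_right mult_zero_right)
  then show False using a Gamma_real_pos[OF a] by simp
qed

text \<open>Watson's lemma at the endpoint: with t = v/b the power
  \<open>(1 + v / b) powr (b - a - 1)\<close> tends to \<open>exp v\<close>, which leaves the ray
  integral with \<open>p = \<xi> - 1\<close>. The condition \<open>Re \<xi> > 1\<close> makes this
  limit, and the majorant, integrable.\<close>

lemma Kummer_tail_asymptotics:
  fixes \<xi> :: complex and a :: real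
  assumes a: "a > 0" and \<xi>: "Re \<xi> > 1"
  obtains L where "L \<noteq> 0"
    "((\<lambda>b. of_real (b powr a) * (LINT t:{0<..}|lborel. exp (- (of_real b * \<xi> * of_real t)) *
        of_real ((1 + t) powr (b - a - 1) * t powr (a - 1)))) \<longlongrightarrow> L) at_top"
proof
  let ?L = "LINT v:{0<..}|lborel. exp (- ((\<xi> - 1) * of_real v)) * of_real (v powr (a - 1))"
  show "?L \<noteq> 0" by (rule exponential_ray_integral_nonzero) (use a \<xi> in auto)
  \<comment> \<open>The integrand after t = v/b; the prefactor \<open>b powr a\<close> cancels the
    Jacobian 1/b and the scaling of \<open>t powr (a - 1)\<close>.\<close>
  define s where "s b v = indicator {0<..} v *\<^sub>R
    (exp (- (\<xi> * of_real v)) * of_real ((1 + v / b) powr (b - a - 1) * v powr (a - 1)))" for b v :: real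
  have eq: "of_real (b powr a) * (LINT t:{0<..}|lborel. exp (- (of_real b * \<xi> * of_real t)) *
        of_real ((1 + t) powr (b - a - 1) * t powr (a - 1))) = (LINT v|lborel. s b v)" if b: "b > 0" for b
  proof -
    let ?f = "\<lambda>t. indicator {0<..} t *\<^sub>R (exp (- (of_real b * \<xi> * of_real t)) *
        complex_of_real ((1 + t) powr (b - a - 1) * t powr (a - 1)))"
    have "(LINT t|lborel. ?f t) = \<bar>1 / b\<bar> *\<^sub>R (LINT v|lborel. ?f (0 + (1 / b) * v))"
      by (rule lborel_integral_real_affine) (use b in auto)
    then have "of_real (b powr a) * (LINT t|lborel. ?f t) =
        (LINT v|lborel. of_real (b powr a / b) * ?f (0 + (1 / b) * v))"
      using b by (simp add: scaleR_conv_of_real)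
    also have "(\<lambda>v. of_real (b powr a / b) * ?f (0 + (1 / b) * v)) = s b"
    proof
      fix v :: real
      show "of_real (b powr a / b) * ?f (0 + (1 / b) * v) = s b v"
      proof (cases "v > 0")
        case True
        have k: "b powr a / b * (v / b) powr (a - 1) = v powr (a - 1)"
          using b True by (simp add: powr_divide powr_diff)
        have "of_real (b powr a / b) * ?f (0 + (1 / b) * v) = exp (- (\<xi> * of_real v)) *
            of_real ((1 + v / b) powr (b - a - 1) * (b powr a / b * (v / b) powr (a - 1)))"
          using b True by simp
        then show ?thesis unfolding k using True by (simp add: s_def)
      qed (use b in \<open>simp add: s_def indicator_def zero_less_divide_iff\<close>)
    qed
    finally show ?thesis by (simp add: set_lebesgue_integral_def)
  qed
  have "((\<lambda>b. LINT v|lborel. s b v) \<longlongrightarrow>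
      (LINT v|lborel. indicator {0<..} v *\<^sub>R (exp (- ((\<xi> - 1) * of_real v)) * of_real (v powr (a - 1))))) at_top"
  proof (rule integral_dominated_convergence_at_top)
    show "integrable lborel (\<lambda>v. indicator {0<..} v *\<^sub>R (v powr (a - 1) * exp (- (Re \<xi> - 1) * v)))"
      using set_integrable_Gamma_kernel[of "a - 1" "Re \<xi> - 1"] a \<xi> unfolding set_integrable_def by simp
    show "s b \<in> borel_measurable lborel" for b
      unfolding s_def by measurable
    show "(\<lambda>v. indicator {0<..} v *\<^sub>R (exp (- ((\<xi> - 1) * of_real v)) * complex_of_real (v powr (a - 1))))
        \<in> borel_measurable lborel" by measurable
    show "AE v in lborel. ((\<lambda>b. s b v) \<longlongrightarrow>
        indicator {0<..} v *\<^sub>R (exp (- ((\<xi> - 1) * of_real v)) * of_real (v powr (a - 1)))) at_top"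
    proof (intro AE_I2)
      fix v :: real
      show "((\<lambda>b. s b v) \<longlongrightarrow>
        indicator {0<..} v *\<^sub>R (exp (- ((\<xi> - 1) * of_real v)) * of_real (v powr (a - 1)))) at_top"
      proof (cases "v > 0")
        case True
        then have l: "((\<lambda>b. (1 + v / b) powr (b - a - 1)) \<longlongrightarrow> exp v) at_top"
          by real_asymp
        have "((\<lambda>b. exp (- (\<xi> * of_real v)) * of_real ((1 + v / b) powr (b - a - 1) * v powr (a - 1)))
          \<longlongrightarrow> exp (- (\<xi> * of_real v)) * of_real (exp v * v powr (a - 1))) at_top"
          by (intro tendsto_intros l)
        also have "exp (- (\<xi> * of_real v)) * of_real (exp v * v powr (a - 1)) =
            exp (- ((\<xi> - 1) * of_real v)) * of_real (v powr (a - 1))"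
          by (simp add: exp_of_real[symmetric] algebra_simps exp_diff exp_minus divide_inverse)
        finally show ?thesis using True by (simp add: s_def)
      qed (simp add: s_def)
    qed
    \<comment> \<open>From \<open>b = a + 1\<close> on, the exponent \<open>b - a - 1\<close> lies
      between 0 and \<open>b\<close>, hence the power is at most \<open>exp v\<close> uniformly in
      \<open>b\<close>.\<close>
    show "\<forall>\<^sub>F b in at_top. AE v in lborel. norm (s b v) \<le>
        indicator {0<..} v *\<^sub>R (v powr (a - 1) * exp (- (Re \<xi> - 1) * v))"
      using eventually_ge_at_top[of "a + 1"]
    proof eventually_elim
      case (elim b)
      have b: "b > 0" using elim a by simp
      have "norm (s b v) \<le> v powr (a - 1) * exp (- (Re \<xi> - 1) * v)" if v: "v > 0" for v
      proof -
        have "(1 + v / b) powr (b - a - 1) \<le> exp (\<bar>b - a - 1\<bar> * (v / b))"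
          using v b by (intro powr_le_exp) auto
        also have "\<bar>b - a - 1\<bar> * (v / b) \<le> b * (v / b)"
          using v b elim a by (intro mult_right_mono) auto
        finally have le: "(1 + v / b) powr (b - a - 1) \<le> exp v" using b by simp
        have "norm (s b v) = exp (- (Re \<xi> * v)) * ((1 + v / b) powr (b - a - 1) * v powr (a - 1))"
          using v by (simp add: s_def norm_mult)
        also have "\<dots> \<le> exp (- (Re \<xi> * v)) * (exp v * v powr (a - 1))"
          using le by (intro mult_left_mono mult_right_mono) auto
        also have "\<dots> = v powr (a - 1) * exp (- (Re \<xi> - 1) * v)"
          by (simp add: algebra_simps exp_diff exp_minus exp_add divide_simps)
        finally show ?thesis .
      qed
      moreover have "s b v = 0" if "\<not> v > 0" for v using that by (simp add: s_def)
      ultimately show ?case by (auto simp: indicator_def)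
    qed
  qed
  then have "((\<lambda>b. LINT v|lborel. s b v) \<longlongrightarrow> ?L) at_top" by (simp add: set_lebesgue_integral_def)
  then show "((\<lambda>b. of_real (b powr a) * (LINT t:{0<..}|lborel. exp (- (of_real b * \<xi> * of_real t)) *
        of_real ((1 + t) powr (b - a - 1) * t powr (a - 1)))) \<longlongrightarrow> ?L) at_top"
  proof (rule Lim_transform_eventually)
    show "\<forall>\<^sub>F b in at_top. (LINT v|lborel. s b v) =
        of_real (b powr a) * (LINT t:{0<..}|lborel. exp (- (of_real b * \<xi> * of_real t)) *
          of_real ((1 + t) powr (b - a - 1) * t powr (a - 1)))"
      using eventually_gt_at_top[of 0] by eventually_elim (rule eq[symmetric])
  qed
qed

section \<open>Splitting into saddle point and endpoint terms\<close>

text \<open>What is left of the integrand on the ray s = t/xi once the kernel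
  \<open>t powr c * exp (- c * t)\<close> with \<open>c = b - a - 1\<close> is removed. The surplus
  \<open>exp (- (a + 1) * t)\<close> comes from \<open>b = c + a + 1\<close>; the amplitude is
  independent of \<open>b\<close> and the kernel peaks exactly at \<open>t = 1\<close>.\<close>

definition Kummer_amplitude :: "real \<Rightarrow> complex \<Rightarrow> real \<Rightarrow> complex" where
  "Kummer_amplitude a \<xi> t = of_real (exp (- (a + 1) * t)) * (1 - inverse \<xi> * of_real t) powr of_real (a - 1)"

text \<open>The connection formula is used with \<open>\<zeta> = b * \<xi>\<close> and the ray
  direction \<open>v = inverse \<xi>\<close>: this ray passes through the saddle, and
  \<open>\<zeta> * s\<close> is real along it. Multiplying by \<open>exp \<zeta>\<close> restores
  Euler's integral and, after a shift by 1, turns the outer integral into the endpoint term.\<close>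

lemma hyp1F1_decomposition:
  fixes \<xi> :: complex and a :: real
  assumes a: "a > 0" and \<xi>: "Re \<xi> > 1" "Im \<xi> > 0"
  shows "\<forall>\<^sub>F b in at_top. of_real (Beta a (b - a)) * hyp1F1 (of_real a) (of_real b) (of_real b * \<xi>) =
      exp (of_real b * \<xi>) * (inverse \<xi> * inverse \<xi> powr of_real (b - a - 1)) *
        (LINT t:{0<..}|lborel. of_real (t powr (b - a - 1) * exp (- (b - a - 1) * t)) * Kummer_amplitude a \<xi> t)
      - exp (\<i> * pi * of_real (a - 1)) * (LINT t:{0<..}|lborel. exp (- (of_real b * \<xi> * of_real t)) *
        of_real ((1 + t) powr (b - a - 1) * t powr (a - 1)))"
  \<comment> \<open>The three thresholds yield \<open>c \<ge> 0\<close>,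
    \<open>Re \<zeta> > c + 2 * \<bar>d\<bar>\<close> and \<open>Im \<zeta> > \<bar>d\<bar>\<close>
    of the connection formula.\<close>
  using eventually_ge_at_top[of "a + 1"] eventually_gt_at_top[of "2 * \<bar>a - 1\<bar> / (Re \<xi> - 1)"]
    eventually_gt_at_top[of "\<bar>a - 1\<bar> / Im \<xi>"]
proof eventually_elim
  case (elim b)
  define \<zeta> where "\<zeta> = of_real b * \<xi>"
  define c where "c = b - a - 1"
  define d where "d = a - 1"
  define v where "v = inverse \<xi>"
  have \<xi>0: "\<xi> \<noteq> 0" using \<xi> by auto
  have c: "c \<ge> 0" "d > -1" "b = c + a + 1" using elim a by (auto simp: c_def d_def)
  have "b * (Re \<xi> - 1) > 2 * \<bar>d\<bar>" "b * Im \<xi> > \<bar>d\<bar>"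
    using elim \<xi> by (simp_all add: d_def field_simps)
  then have z: "Re \<zeta> > c + 2 * \<bar>d\<bar>" "Im \<zeta> > \<bar>d\<bar>"
    using c a by (auto simp: \<zeta>_def algebra_simps)
  have v: "Re v > 0" "Im v < 0"
    using \<xi> \<xi>0 by (auto simp: v_def divide_neg_pos complex_neq_0[symmetric] sum_power2_gt_zero_iff)
  have 1: "exp \<zeta> * (LINT s:{0..1}|lborel. exp (- (\<zeta> * of_real s)) * of_real (s powr c * (1 - s) powr d)) =
      of_real (Beta a (b - a)) * hyp1F1 (of_real a) (of_real b) \<zeta>"
  proof -
    have "exp \<zeta> * (LINT s:{0..1}|lborel. exp (- (\<zeta> * of_real s)) * of_real (s powr c * (1 - s) powr d)) =
        (LINT s:{0..1}|lborel. exp \<zeta> * (exp (- (\<zeta> * of_real s)) * of_real (s powr c * (1 - s) powr d)))"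
      by (rule set_integral_mult_right[symmetric])
    also have "\<dots> = (LINT s:{0..1}|lborel. exp (\<zeta> * of_real (1 - s)) * of_real (s powr c * (1 - s) powr d))"
      by (simp add: algebra_simps exp_diff exp_minus divide_inverse)
    also have "\<dots> = of_real (Beta a (b - a)) * hyp1F1 (of_real a) (of_real b) \<zeta>"
      unfolding c_def d_def using hyp1F1_Euler(1)[of a b \<zeta>] a elim by simp
    finally show ?thesis .
  qed
  have 2: "exp \<zeta> * (LINT s:{1<..}|lborel. exp (- (\<zeta> * of_real s)) * of_real (s powr c * (s - 1) powr d)) =
      (LINT t:{0<..}|lborel. exp (- (\<zeta> * of_real t)) * of_real ((1 + t) powr c * t powr d))"
  proof -
    have "exp \<zeta> * (LINT s:{1<..}|lborel. exp (- (\<zeta> * of_real s)) * of_real (s powr c * (s - 1) powr d)) =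
        (LINT t:{0<..}|lborel. exp \<zeta> * (exp (- (\<zeta> * of_real (1 + t))) * of_real ((1 + t) powr c * ((1 + t) - 1) powr d)))"
      by (subst set_integral_mult_right, subst set_integrable_shift_1(2)) (rule refl)
    also have "\<dots> = (LINT t:{0<..}|lborel. exp (- (\<zeta> * of_real t)) * of_real ((1 + t) powr c * t powr d))"
      by (simp add: algebra_simps exp_diff exp_minus exp_add divide_inverse)
    finally show ?thesis .
  qed
  have 3: "(LINT r:{0<..}|lborel. v * Kummer_integrand \<zeta> c d (v * of_real r)) =
     v * v powr of_real c * (LINT t:{0<..}|lborel. of_real (t powr c * exp (- c * t)) * Kummer_amplitude a \<xi> t)"
  proof (subst set_integral_mult_right[symmetric], rule set_lebesgue_integral_cong)
    show "\<forall>r. r \<in> {0<..} \<longrightarrow> v * Kummer_integrand \<zeta> c d (v * of_real r) =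
        v * v powr of_real c * (of_real (r powr c * exp (- c * r)) * Kummer_amplitude a \<xi> r)"
    proof (intro allI impI)
      fix r :: real assume r: "r \<in> {0<..}"
      have "\<zeta> * (v * of_real r) = of_real (b * r)" using \<xi>0 by (simp add: \<zeta>_def v_def)
      then have "exp (- (\<zeta> * (v * of_real r))) = complex_of_real (exp (- (b * r)))"
        by (metis exp_of_real of_real_minus)
      moreover have "exp (- (b * r)) = exp (- c * r) * exp (- (a + 1) * r)"
        by (simp add: c(3) exp_add[symmetric] algebra_simps)
      ultimately have "exp (- (\<zeta> * (v * of_real r))) = complex_of_real (exp (- c * r) * exp (- (a + 1) * r))"
        by (simp only:)
      moreover have "(v * of_real r) powr of_real c = v powr of_real c * of_real (r powr c)"
        using powr_times_real_left[of "of_real r" v "of_real c"] r by (simp add: powr_of_real mult.commute)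
      ultimately show "v * Kummer_integrand \<zeta> c d (v * of_real r) =
          v * v powr of_real c * (of_real (r powr c * exp (- c * r)) * Kummer_amplitude a \<xi> r)"
        by (simp only: Kummer_integrand_def Kummer_amplitude_def d_def v_def of_real_mult mult_ac)
    qed
  qed simp
  have "(LINT s:{0..1}|lborel. exp (- (\<zeta> * of_real s)) * of_real (s powr c * (1 - s) powr d))
      = (LINT r:{0<..}|lborel. v * Kummer_integrand \<zeta> c d (v * of_real r))
      - exp (\<i> * pi * d) * (LINT s:{1<..}|lborel. exp (- (\<zeta> * of_real s)) * of_real (s powr c * (s - 1) powr d))"
    using Kummer_connection[OF z c(1,2) v] by (simp only: eq_diff_eq)
  then have "exp \<zeta> * (LINT s:{0..1}|lborel. exp (- (\<zeta> * of_real s)) * of_real (s powr c * (1 - s) powr d))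
      = exp \<zeta> * (LINT r:{0<..}|lborel. v * Kummer_integrand \<zeta> c d (v * of_real r))
      - exp (\<i> * pi * d) * (exp \<zeta> * (LINT s:{1<..}|lborel. exp (- (\<zeta> * of_real s)) * of_real (s powr c * (s - 1) powr d)))"
    by (simp only: right_diff_distrib mult.left_commute)
  then show ?case
    unfolding 1 2 3 unfolding \<zeta>_def c_def d_def v_def by (simp only: mult.assoc)
qed

text \<open>These are the hypotheses of \<open>Laplace_at_1\<close>. The ray in direction
  \<open>inverse \<xi>\<close> runs strictly below the axis and so avoids the cut; for
  \<open>a < 1\<close> the singular factor stays bounded because
  \<open>norm (\<xi> - t) \<ge> Im \<xi>\<close>.\<close>

lemma Kummer_amplitude_properties:
  fixes \<xi> :: complex and a :: real
  assumes a: "a > 0" and \<xi>: "Re \<xi> > 1" "Im \<xi> > 0"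
  shows "continuous_on {0<..} (Kummer_amplitude a \<xi>)"
    and "set_integrable lborel {0<..} (Kummer_amplitude a \<xi>)"
    and "Kummer_amplitude a \<xi> 1 \<noteq> 0"
proof -
  define v where "v = inverse \<xi>"
  define d where "d = a - 1"
  have \<xi>0: "\<xi> \<noteq> 0" using \<xi> by auto
  have iv: "Im v < 0"
    using \<xi> \<xi>0 by (auto simp: v_def divide_neg_pos complex_neq_0[symmetric] sum_power2_gt_zero_iff)
  have nx: "norm \<xi> > 1" using complex_Re_le_cmod[of \<xi>] \<xi> by simp
  have nv: "0 < norm v" "norm v \<le> 1" using nx \<xi>0 by (auto simp: v_def norm_inverse inverse_le_1_iff)
  have notin: "1 - v * of_real t \<notin> \<real>\<^sub>\<le>\<^sub>0" if "t > 0" for t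
    using that iv mult_neg_pos[of "Im v" t] by (auto simp: complex_nonpos_Reals_iff)
  show cont: "continuous_on {0<..} (Kummer_amplitude a \<xi>)"
  proof -
    have "(\<lambda>w. w powr complex_of_real (a - 1)) holomorphic_on - \<real>\<^sub>\<le>\<^sub>0"
      by (intro holomorphic_intros) auto
    then have powr: "continuous_on (- \<real>\<^sub>\<le>\<^sub>0) (\<lambda>w. w powr complex_of_real (a - 1))"
      by (rule holomorphic_on_imp_continuous_on)
    have lin: "continuous_on {0<..} (\<lambda>t. 1 - v * of_real t)" by (intro continuous_intros)
    have "continuous_on {0<..} (\<lambda>t. (1 - v * of_real t) powr of_real (a - 1))"
      by (rule continuous_on_compose2[OF powr lin]) (use notin in auto)
    moreover have "continuous_on {0<..} (\<lambda>t. complex_of_real (exp (- (a + 1) * t)))"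
      by (intro continuous_intros)
    ultimately show ?thesis
      unfolding Kummer_amplitude_def v_def[symmetric] by (rule continuous_on_mult[rotated])
  qed
  show "Kummer_amplitude a \<xi> 1 \<noteq> 0"
    using notin[of 1] by (auto simp: Kummer_amplitude_def v_def)
  define D where "D = (Im \<xi> * norm v) powr d"
  have D: "norm (1 - v * of_real t) powr d \<le> (1 + D) * exp (\<bar>d\<bar> * t)" if t: "t > 0" for t
  proof (cases "d \<ge> 0")
    case True
    have "norm (1 - v * of_real t) \<le> 1 + norm v * t"
      using norm_triangle_ineq4[of 1 "v * of_real t"] t by (simp add: norm_mult)
    also have "\<dots> \<le> 1 + t" using nv t by simp
    finally have "norm (1 - v * of_real t) powr d \<le> (1 + t) powr d" using True by (intro powr_mono2) auto
    also have "\<dots> \<le> exp (\<bar>d\<bar> * t)" using t by (intro powr_le_exp) auto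
    also have "\<dots> \<le> (1 + D) * exp (\<bar>d\<bar> * t)" by (simp add: D_def distrib_right)
    finally show ?thesis .
  next
    case False
    have "1 - v * of_real t = v * (\<xi> - of_real t)" using \<xi>0 by (simp add: v_def algebra_simps)
    moreover have "Im \<xi> \<le> norm (\<xi> - of_real t)" using abs_Im_le_cmod[of "\<xi> - of_real t"] by simp
    ultimately have "Im \<xi> * norm v \<le> norm (1 - v * of_real t)"
      using nv by (simp add: norm_mult mult.commute)
    then have "norm (1 - v * of_real t) powr d \<le> D"
      unfolding D_def using False \<xi> nv by (intro powr_mono2') auto
    also have "\<dots> \<le> (1 + D) * exp (\<bar>d\<bar> * t)"
      using mult_mono[of D "1 + D" 1 "exp (\<bar>d\<bar> * t)"] t by (simp add: D_def)
    finally show ?thesis .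
  qed
  show "set_integrable lborel {0<..} (Kummer_amplitude a \<xi>)"
  proof (rule set_integrable_bound_continuous[OF _ cont])
    \<comment> \<open>The value is \<open>min 2 (2 * a)\<close>.\<close>
    have "a + 1 - \<bar>d\<bar> > 0" using a by (auto simp: d_def)
    then show "set_integrable lborel {0<..} (\<lambda>t. (1 + D) * (t powr 0 * exp (- (a + 1 - \<bar>d\<bar>) * t)))"
      by (intro set_integrable_mult_right set_integrable_Gamma_kernel) auto
    show "norm (Kummer_amplitude a \<xi> t) \<le> (1 + D) * (t powr 0 * exp (- (a + 1 - \<bar>d\<bar>) * t))"
      if "t \<in> {0<..}" for t
    proof -
      have "norm (Kummer_amplitude a \<xi> t) = exp (- (a + 1) * t) * norm (1 - v * of_real t) powr d"
        unfolding Kummer_amplitude_def v_def[symmetric] d_def norm_mult norm_of_real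
        by (subst norm_powr_real_powr') auto
      also have "\<dots> \<le> exp (- (a + 1) * t) * ((1 + D) * exp (\<bar>d\<bar> * t))"
        using D that by (intro mult_left_mono) auto
      also have "\<dots> = (1 + D) * (exp (- (a + 1) * t) * exp (\<bar>d\<bar> * t))" by simp
      also have "exp (- (a + 1) * t) * exp (\<bar>d\<bar> * t) = t powr 0 * exp (- (a + 1 - \<bar>d\<bar>) * t)"
        using that by (simp add: exp_add[symmetric] algebra_simps)
      finally show ?thesis .
    qed
  qed auto
qed

text \<open>\<open>Beta a (b - a)\<close> is the normalisation of Euler's integral and
  \<open>b powr a\<close> compensates the decay of the endpoint term. For \<open>b > a > 0\<close>
  both are positive, so no zeros are added or lost.\<close>

definition scaled_hyp1F1 :: "real \<Rightarrow> real \<Rightarrow> complex \<Rightarrow> complex" where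
  "scaled_hyp1F1 a b \<xi> =
     of_real (b powr a * Beta a (b - a)) * hyp1F1 (of_real a) (of_real b) (of_real b * \<xi>)"

text \<open>\<open>X\<close> is the saddle term and \<open>Y\<close> the endpoint term. The modulus
  of \<open>exp (b * \<xi>)\<close> times the power of \<open>inverse \<xi>\<close>, combined with
  the peak value \<open>exp (- (b - a - 1))\<close> of the kernel, gives
  \<open>exp (\<phi> * b)\<close> up to a constant.\<close>

lemma scaled_hyp1F1_split:
  fixes \<xi> :: complex and a :: real
  assumes a: "a > 0" and \<xi>: "Re \<xi> > 1" "Im \<xi> > 0"
  defines "\<phi> \<equiv> Re \<xi> - 1 - ln (norm \<xi>)"
  obtains X :: "real \<Rightarrow> complex" and Y L C K
  where "\<forall>\<^sub>F b in at_top. scaled_hyp1F1 a b \<xi> = X b - Y b" "(Y \<longlongrightarrow> L) at_top" "L \<noteq> 0" "K \<ge> 1"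
    "\<forall>\<^sub>F b in at_top. norm (X b) \<le> C * (b powr a * exp (\<phi> * b))"
    "\<And>\<kappa>. \<kappa> > 0 \<Longrightarrow> \<forall>\<^sub>F b in at_top. norm (X b) \<ge> K * exp ((\<phi> - \<kappa>) * b)"
proof -
  define P where "P c = (LINT t:{0<..}|lborel. of_real (t powr c * exp (- c * t)) * Kummer_amplitude a \<xi> t)" for c
  define X where "X b = of_real (b powr a) * (exp (of_real b * \<xi>) *
    (inverse \<xi> * inverse \<xi> powr of_real (b - a - 1)) * P (b - a - 1))" for b
  define T where "T b = of_real (b powr a) * (LINT t:{0<..}|lborel. exp (- (of_real b * \<xi> * of_real t)) *
        of_real ((1 + t) powr (b - a - 1) * t powr (a - 1)))" for b
  define e where "e = exp (\<i> * pi * of_real (a - 1))"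
  obtain L where L: "L \<noteq> 0" "(T \<longlongrightarrow> L) at_top"
    unfolding T_def by (rule Kummer_tail_asymptotics[OF a \<xi>(1)])
  have split: "\<forall>\<^sub>F b in at_top. scaled_hyp1F1 a b \<xi> = X b - e * T b"
    using hyp1F1_decomposition[OF a \<xi>]
  proof eventually_elim
    case (elim b)
    have "scaled_hyp1F1 a b \<xi> = of_real (b powr a) *
        (of_real (Beta a (b - a)) * hyp1F1 (of_real a) (of_real b) (of_real b * \<xi>))"
      by (simp add: scaled_hyp1F1_def)
    then show ?case
      unfolding elim X_def T_def e_def P_def by (simp only: right_diff_distrib mult.left_commute)
  qed
  have nx: "norm \<xi> > 1" using complex_Re_le_cmod[of \<xi>] \<xi> by simp
  \<comment> \<open>\<open>K\<close> collects the factors free of \<open>b\<close> when the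
    exponents \<open>b - a\<close> and \<open>b - a - 1\<close> are rewritten in terms of
    \<open>b\<close>.\<close>
  define K where "K = exp (a * ln (norm \<xi>) + a + 1)"
  have K: "K \<ge> 1" using nx a by (simp add: K_def)
  have normX: "norm (X b) = K * (b powr a * exp (\<phi> * b)) * (exp (b - a - 1) * norm (P (b - a - 1)))" for b
  proof -
    have "norm \<xi> > 0" using nx by linarith
    then have i: "norm (inverse \<xi>) = exp (- ln (norm \<xi>))" by (simp only: norm_inverse exp_minus exp_ln)
    then have "norm (inverse \<xi>) powr (b - a - 1) = exp ((b - a - 1) * - ln (norm \<xi>))"
      by (simp add: powr_def)
    moreover have "norm (inverse \<xi> powr of_real (b - a - 1)) = norm (inverse \<xi>) powr (b - a - 1)"
      by (subst norm_powr_real_powr') auto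
    ultimately have "norm (inverse \<xi> * inverse \<xi> powr of_real (b - a - 1))
        = exp (- ln (norm \<xi>)) * exp ((b - a - 1) * - ln (norm \<xi>))"
      by (simp only: norm_mult i)
    also have "\<dots> = exp (- (b - a) * ln (norm \<xi>))"
      by (simp add: exp_add[symmetric] algebra_simps)
    finally have iv: "norm (inverse \<xi> * inverse \<xi> powr of_real (b - a - 1)) = exp (- (b - a) * ln (norm \<xi>))" .
    have "norm (exp (of_real b * \<xi>)) = exp (b * Re \<xi>)" by simp
    with iv have "norm (X b) = b powr a * (exp (b * Re \<xi>) * exp (- (b - a) * ln (norm \<xi>))) * norm (P (b - a - 1))"
      unfolding X_def norm_mult[of "of_real (b powr a)"] norm_mult[of _ "P (b - a - 1)"]
        norm_mult[of "exp (of_real b * \<xi>)"] by simp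
    also have "exp (b * Re \<xi>) * exp (- (b - a) * ln (norm \<xi>)) = K * exp (\<phi> * b) * exp (b - a - 1)"
      by (simp add: K_def \<phi>_def exp_add[symmetric] algebra_simps)
    finally show ?thesis by (simp only: mult_ac)
  qed
  note amp = Kummer_amplitude_properties[OF a \<xi>]
  have "filterlim (\<lambda>b. b - a - 1) at_top at_top" by real_asymp
  note shift = eventually_compose_filterlim[OF _ this]
  obtain C where C: "\<And>c. c \<ge> 0 \<Longrightarrow> norm (P c) \<le> C * exp (- c)"
    using Laplace_at_1(1)[OF amp(1,2)] unfolding P_def by blast
  show thesis
  proof (rule that[of X "\<lambda>b. e * T b" "e * L" K "K * C"])
    show "\<forall>\<^sub>F b in at_top. scaled_hyp1F1 a b \<xi> = X b - e * T b" by (rule split)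
    show "((\<lambda>b. e * T b) \<longlongrightarrow> e * L) at_top" using L by (intro tendsto_intros)
    show "e * L \<noteq> 0" using L by (simp add: e_def)
    show "K \<ge> 1" by (rule K)
    show "\<forall>\<^sub>F b in at_top. norm (X b) \<le> K * C * (b powr a * exp (\<phi> * b))"
      using eventually_ge_at_top[of "a + 1"]
    proof eventually_elim
      case (elim b)
      have "exp (b - a - 1) * norm (P (b - a - 1)) \<le> exp (b - a - 1) * (C * exp (- (b - a - 1)))"
        using elim C[of "b - a - 1"] by (intro mult_left_mono) auto
      also have "\<dots> = C" by (simp add: mult.left_commute exp_add[symmetric])
      finally have "norm (X b) \<le> K * (b powr a * exp (\<phi> * b)) * C"
        unfolding normX using K by (intro mult_left_mono) auto
      then show ?case by (simp only: mult_ac)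
    qed
    show "\<forall>\<^sub>F b in at_top. norm (X b) \<ge> K * exp ((\<phi> - \<kappa>) * b)" if \<kappa>: "\<kappa> > 0" for \<kappa>
      using shift[OF Laplace_at_1(2)[OF amp \<kappa>]] eventually_ge_at_top[of "a + 1"]
    proof eventually_elim
      case (elim b)
      have b: "b \<ge> 1" using elim a by simp
      have "exp (- \<kappa> * b) \<le> exp (- \<kappa> * (b - a - 1))" using \<kappa> a by simp
      also have "\<dots> = exp (b - a - 1) * exp (- (1 + \<kappa>) * (b - a - 1))"
        by (simp add: exp_add[symmetric] algebra_simps)
      also have "\<dots> \<le> exp (b - a - 1) * norm (P (b - a - 1))"
        using elim by (intro mult_left_mono) (auto simp: P_def)
      finally have l: "exp (- \<kappa> * b) \<le> exp (b - a - 1) * norm (P (b - a - 1))" .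
      have "1 \<le> b powr a" using b a by (simp add: ge_one_powr_ge_zero)
      then have "1 * exp (\<phi> * b) \<le> b powr a * exp (\<phi> * b)" by (intro mult_right_mono) auto
      then have "K * (1 * exp (\<phi> * b)) * exp (- \<kappa> * b) \<le> norm (X b)"
        unfolding normX using K l by (intro mult_mono mult_left_mono) auto
      moreover have "K * (1 * exp (\<phi> * b)) * exp (- \<kappa> * b) = K * exp ((\<phi> - \<kappa>) * b)"
        by (simp add: exp_add[symmetric] algebra_simps)
      ultimately show ?case by (simp only:)
    qed
  qed
qed

text \<open>For a negative rate the exponential decay of the saddle term outweighs
  \<open>b powr a\<close>, and only the endpoint term survives.\<close>

lemma scaled_hyp1F1_tendsto:
  fixes \<xi> :: complex and a :: real
  assumes a: "a > 0" and \<xi>: "Re \<xi> > 1" "Im \<xi> > 0" and neg: "Re \<xi> - 1 < ln (norm \<xi>)"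
  shows "\<exists>L. L \<noteq> 0 \<and> ((\<lambda>b. scaled_hyp1F1 a b \<xi>) \<longlongrightarrow> L) at_top"
proof -
  obtain X :: "real \<Rightarrow> complex" and Y L C K
    where X: "\<forall>\<^sub>F b in at_top. scaled_hyp1F1 a b \<xi> = X b - Y b" "(Y \<longlongrightarrow> L) at_top" "L \<noteq> 0" "K \<ge> (1::real)"
    "\<forall>\<^sub>F b in at_top. norm (X b) \<le> C * (b powr a * exp ((Re \<xi> - 1 - ln (norm \<xi>)) * b))"
    by (rule scaled_hyp1F1_split[OF a \<xi>])
  have "((\<lambda>b. b powr a * exp (- (ln (norm \<xi>) - (Re \<xi> - 1)) * b)) \<longlongrightarrow> 0) at_top"
    using neg a by (intro powr_times_exp_tendsto_0) auto
  then have "((\<lambda>b. C * (b powr a * exp ((Re \<xi> - 1 - ln (norm \<xi>)) * b))) \<longlongrightarrow> 0) at_top"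
    by (intro tendsto_mult_right_zero) simp
  then have "(X \<longlongrightarrow> 0) at_top" by (rule Lim_null_comparison[OF X(5)])
  then have "((\<lambda>b. X b - Y b) \<longlongrightarrow> 0 - L) at_top" using X(2) by (rule tendsto_diff)
  then have "((\<lambda>b. scaled_hyp1F1 a b \<xi>) \<longlongrightarrow> 0 - L) at_top"
    by (rule Lim_transform_eventually) (use X(1) in \<open>auto elim: eventually_mono\<close>)
  then show ?thesis using X(3) by (intro exI[of _ "0 - L"]) simp
qed

lemma scaled_hyp1F1_exponential_growth:
  fixes \<xi> :: complex and a :: real
  assumes a: "a > 0" and \<xi>: "Re \<xi> > 1" "Im \<xi> > 0" and pos: "Re \<xi> - 1 > ln (norm \<xi>)"
  shows "\<exists>\<kappa>>0. \<forall>\<^sub>F b in at_top. norm (scaled_hyp1F1 a b \<xi>) \<ge> exp (\<kappa> * b)"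
proof -
  define \<phi> where "\<phi> = Re \<xi> - 1 - ln (norm \<xi>)"
  have \<phi>: "\<phi> > 0" using pos by (simp add: \<phi>_def)
  obtain X :: "real \<Rightarrow> complex" and Y L C K
    where X: "\<forall>\<^sub>F b in at_top. scaled_hyp1F1 a b \<xi> = X b - Y b" "(Y \<longlongrightarrow> L) at_top" "L \<noteq> 0" "K \<ge> 1"
    "\<forall>\<^sub>F b in at_top. norm (X b) \<le> C * (b powr a * exp (\<phi> * b))"
    "\<And>\<kappa>. \<kappa> > 0 \<Longrightarrow> \<forall>\<^sub>F b in at_top. norm (X b) \<ge> K * exp ((\<phi> - \<kappa>) * b)"
    unfolding \<phi>_def by (rule scaled_hyp1F1_split[OF a \<xi>]) blast
  have "((\<lambda>b. norm (Y b)) \<longlongrightarrow> norm L) at_top" using X(2) by (rule tendsto_norm)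
  then have Y: "\<forall>\<^sub>F b in at_top. norm (Y b) < norm L + 1" by (rule order_tendstoD) simp
  have "filterlim (\<lambda>b. exp (\<phi> / 4 * b)) at_top at_top"
    using \<phi> by real_asymp
  then have "\<forall>\<^sub>F b in at_top. exp (\<phi> / 4 * b) \<ge> norm L + 2"
    by (simp add: filterlim_at_top)
  \<comment> \<open>Half of the rate is given up in the Laplace bound, another quarter to absorb the
    bounded endpoint term: with \<open>x = exp (\<phi> / 4 * b) \<ge> norm L + 2\<close> one has
    \<open>x * (x - 1) \<ge> norm L + 1\<close>.\<close>
  then have "\<forall>\<^sub>F b in at_top. exp (\<phi> / 2 * b) - (norm L + 1) \<ge> exp (\<phi> / 4 * b)"
  proof eventually_elim
    case (elim b)
    have "1 * (norm L + 1) \<le> exp (\<phi> / 4 * b) * (exp (\<phi> / 4 * b) - 1)"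
      using elim norm_ge_zero[of L] by (intro mult_mono) linarith+
    also have "\<dots> = exp (\<phi> / 2 * b) - exp (\<phi> / 4 * b)"
      by (simp add: right_diff_distrib exp_add[symmetric])
    finally show ?case by simp
  qed
  then have "\<forall>\<^sub>F b in at_top. norm (scaled_hyp1F1 a b \<xi>) \<ge> exp (\<phi> / 4 * b)"
    using Y X(1) X(6)[of "\<phi> / 2", OF half_gt_zero[OF \<phi>]]
  proof eventually_elim
    case (elim b)
    have half: "\<phi> - \<phi> / 2 = \<phi> / 2" by simp
    have "1 * exp (\<phi> / 2 * b) \<le> K * exp (\<phi> / 2 * b)" using X(4) by (intro mult_right_mono) auto
    moreover have "norm (X b) - norm (Y b) \<le> norm (scaled_hyp1F1 a b \<xi>)"
      unfolding elim(3) by (rule norm_triangle_ineq2)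
    ultimately show ?case using elim unfolding half by linarith
  qed
  then show ?thesis using \<phi> by (intro exI[of _ "\<phi> / 4"]) simp
qed

section \<open>Zeros\<close>

text \<open>If \<open>h b\<close> had no zeros for arbitrarily large \<open>b\<close>, the holomorphic roots \<open>h b powr (1 / b)\<close> would form
  a normal family, with a limit of modulus 1 on \<open>U\<close>, hence constant; but its modulus at \<open>w\<close> exceeds 1.\<close>

lemma eventually_has_zero:
  fixes h :: "real \<Rightarrow> complex \<Rightarrow> complex" and M b0 \<kappa> r :: real
  assumes holo: "\<And>b. b \<ge> b0 \<Longrightarrow> h b holomorphic_on ball z0 r"
    and bound: "\<And>b z. b \<ge> b0 \<Longrightarrow> z \<in> ball z0 r \<Longrightarrow> norm (h b z) \<le> exp (M * b)"
    and U: "open U" "U \<noteq> {}" "U \<subseteq> ball z0 r"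
    and lim: "\<And>z. z \<in> U \<Longrightarrow> \<exists>L. L \<noteq> 0 \<and> ((\<lambda>b. h b z) \<longlongrightarrow> L) at_top"
    and w: "w \<in> ball z0 r" "\<kappa> > 0" "\<forall>\<^sub>F b in at_top. norm (h b w) \<ge> exp (\<kappa> * b)"
  shows "\<forall>\<^sub>F b in at_top. \<exists>z\<in>ball z0 r. h b z = 0"
proof (rule ccontr)
  let ?D = "ball z0 r"
  assume "\<not> ?thesis"
  then have "\<forall>N. \<exists>b\<ge>N. \<forall>z\<in>?D. h b z \<noteq> 0"
    by (simp add: eventually_at_top_linorder)
  then have "\<exists>b\<ge>max (real n) (max b0 1). \<forall>z\<in>?D. h b z \<noteq> 0" for n by (rule spec)
  then obtain b where b: "\<And>n. b n \<ge> max (real n) (max b0 1)" "\<And>n z. z \<in> ?D \<Longrightarrow> h (b n) z \<noteq> 0"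
    by metis
  have b': "b n \<ge> real n" "b n \<ge> b0" "b n > 0" for n using b(1)[of n] by auto
  have "\<exists>l. l holomorphic_on ?D \<and> (\<forall>z\<in>?D. h (b n) z = exp (l z))" for n
    using contractible_imp_holomorphic_log[OF holo[OF b'(2)[of n]] convex_imp_contractible[OF convex_ball] b(2)[of _ n]]
    by metis
  then obtain l where l: "\<And>n. l n holomorphic_on ?D" "\<And>n z. z \<in> ?D \<Longrightarrow> h (b n) z = exp (l n z)"
    by metis
  have nh: "norm (h (b n) z) = exp (Re (l n z))" if "z \<in> ?D" for n z
    using l(2)[OF that] by simp
  \<comment> \<open>The \<open>b n\<close>-th root through a holomorphic logarithm, available since
    the disc is contractible. Its modulus is at most \<open>exp M\<close>, a bound free of
    \<open>n\<close>.\<close>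
  define g where "g n z = exp (l n z / of_real (b n))" for n z
  have ng: "norm (g n z) = exp (Re (l n z) / b n)" for n z by (simp add: g_def)
  have hg: "g n holomorphic_on ?D" for n
    unfolding g_def using b'(3)[of n] by (intro holomorphic_intros l) auto
  have bg: "norm (g n z) \<le> exp M" if "z \<in> ?D" for n z
  proof -
    have "Re (l n z) \<le> M * b n" using bound[OF b'(2) that, of n] nh[OF that, of n] by simp
    then show ?thesis using b'(3)[of n] by (simp add: ng field_simps)
  qed
  define \<H> where "\<H> = {f. f holomorphic_on ?D \<and> (\<forall>z\<in>?D. norm (f z) \<le> exp M)}"
  obtain G \<rho> where G: "G holomorphic_on ?D" "strict_mono \<rho>"
    "\<And>z. z \<in> ?D \<Longrightarrow> (\<lambda>n. g (\<rho> n) z) \<longlonglongrightarrow> G z"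
  proof (rule Montel[of ?D \<H> g])
    show "open ?D" by simp
    show "f holomorphic_on ?D" if "f \<in> \<H>" for f using that by (simp add: \<H>_def)
    show "\<exists>B. \<forall>f\<in>\<H>. \<forall>z\<in>K. norm (f z) \<le> B" if "compact K" "K \<subseteq> ?D" for K
      using that by (intro exI[of _ "exp M"]) (auto simp: \<H>_def)
    show "range g \<subseteq> \<H>" using hg bg by (auto simp: \<H>_def)
  qed blast
  have "filterlim (\<lambda>n. b n) at_top sequentially"
    by (rule filterlim_at_top_mono[OF filterlim_real_sequentially]) (use b' in auto)
  then have b\<rho>: "filterlim (\<lambda>n. b (\<rho> n)) at_top sequentially"
    using filterlim_compose[OF _ filterlim_subseq[OF G(2)]] by blast
  \<comment> \<open>On \<open>U\<close> the logarithm of the modulus converges to the finite number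
    \<open>ln (norm L)\<close>, so division by \<open>b\<close> sends it to 0. This is where
    \<open>L \<noteq> 0\<close> matters.\<close>
  have unit: "norm (G z) = 1" if z: "z \<in> U" for z
  proof -
    have zD: "z \<in> ?D" using z U by auto
    obtain L where L: "L \<noteq> 0" "((\<lambda>b. h b z) \<longlongrightarrow> L) at_top" using lim[OF z] by blast
    have "(\<lambda>n. norm (h (b (\<rho> n)) z)) \<longlonglongrightarrow> norm L"
      by (intro tendsto_norm filterlim_compose[OF L(2) b\<rho>])
    then have "(\<lambda>n. ln (norm (h (b (\<rho> n)) z))) \<longlonglongrightarrow> ln (norm L)"
      using L(1) by (intro tendsto_ln) auto
    then have "(\<lambda>n. Re (l (\<rho> n) z)) \<longlonglongrightarrow> ln (norm L)" unfolding nh[OF zD] by simp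
    then have "(\<lambda>n. Re (l (\<rho> n) z) / b (\<rho> n)) \<longlonglongrightarrow> 0"
      by (rule real_tendsto_divide_at_top[OF _ b\<rho>])
    then have "(\<lambda>n. norm (g (\<rho> n) z)) \<longlonglongrightarrow> exp 0"
      unfolding ng by (rule tendsto_exp)
    then show ?thesis using LIMSEQ_unique[OF tendsto_norm[OF G(3)[OF zD]]] by simp
  qed
  obtain z1 where z1: "z1 \<in> U" using U by auto
  have "G constant_on ?D"
  proof (rule ccontr)
    assume nc: "\<not> G constant_on ?D"
    have "open (G ` U)"
      by (rule open_mapping_thm[OF G(1) open_ball connected_ball U(1,3) nc])
    then obtain e where e: "e > 0" "ball (G z1) e \<subseteq> G ` U"
      using z1 open_contains_ball by blast
    \<comment> \<open>Pushing \<open>G z1\<close> radially outwards stays within the image of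
      \<open>U\<close>, which is open if \<open>G\<close> is not constant, but leaves the unit
      circle.\<close>
    define q where "q = (1 + of_real (e / 2)) * G z1"
    have "norm (q - G z1) = e / 2 * norm (G z1)"
      using e by (simp add: q_def algebra_simps norm_mult norm_divide)
    then have "q \<in> ball (G z1) e" using e unit[OF z1] by (simp add: dist_norm norm_minus_commute)
    then have "norm q = 1" using e unit by auto
    moreover have "norm q = 1 + e / 2"
    proof -
      have "norm (1 + complex_of_real (e / 2)) = \<bar>1 + e / 2\<bar>" by (metis norm_of_real of_real_1 of_real_add)
      then show ?thesis using e unit[OF z1] by (simp add: q_def norm_mult del: of_real_divide)
    qed
    ultimately show False using e by simp
  qed
  then have "G w = G z1" using w(1) z1 U by (auto simp: constant_on_def)
  then have "norm (G w) = 1" using unit[OF z1] by simp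
  moreover have "exp \<kappa> \<le> norm (G w)"
  proof (rule tendsto_lowerbound[OF tendsto_norm[OF G(3)[OF w(1)]]])
    show "\<forall>\<^sub>F n in sequentially. exp \<kappa> \<le> norm (g (\<rho> n) w)"
      using eventually_compose_filterlim[OF w(3) b\<rho>]
    proof eventually_elim
      case (elim n)
      then have "\<kappa> * b (\<rho> n) \<le> Re (l (\<rho> n) w)" using nh[OF w(1)] by simp
      then show ?case using b'(3)[of "\<rho> n"] by (simp add: ng field_simps)
    qed
  qed simp
  ultimately show False using w(2) by simp
qed

section \<open>From zeros in every disc to a convergent family\<close>

text \<open>The threshold for \<open>b\<close> depends on \<open>e\<close>, so one choice per
  \<open>b\<close> must serve all \<open>e\<close>. It is taken within \<open>1 / b\<close> of the
  infimum of the distances to \<open>l\<close>, since that infimum need not be attained.\<close>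

lemma ex_selection_tendsto:
  fixes P :: "real \<Rightarrow> 'a::metric_space \<Rightarrow> bool"
  assumes ev: "\<And>e. e > 0 \<Longrightarrow> \<forall>\<^sub>F b in at_top. \<exists>z. P b z \<and> dist z l < e"
  shows "\<exists>f. (\<forall>\<^sub>F b in at_top. P b (f b)) \<and> (f \<longlongrightarrow> l) at_top"
proof -
  define Q where "Q b = (\<lambda>z. dist z l) ` {z. P b z}" for b
  define f where "f b = (SOME z. P b z \<and> dist z l < Inf (Q b) + 1 / b)" for b
  have f: "P b (f b) \<and> dist (f b) l < Inf (Q b) + 1 / b" if "P b z" "b > 0" for b z
  proof -
    have "Q b \<noteq> {}" using that by (auto simp: Q_def)
    moreover have "Inf (Q b) < Inf (Q b) + 1 / b" using that by simp
    ultimately obtain y where "y \<in> Q b" "y < Inf (Q b) + 1 / b" by (meson cInf_lessD)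
    then have "\<exists>z. P b z \<and> dist z l < Inf (Q b) + 1 / b" by (auto simp: Q_def)
    then show ?thesis unfolding f_def by (rule someI_ex)
  qed
  have bdd: "bdd_below (Q b)" for b by (auto simp: Q_def intro: bdd_belowI[of _ 0])
  have "\<forall>\<^sub>F b in at_top. P b (f b)"
    using ev[OF zero_less_one] eventually_gt_at_top[of 0] by eventually_elim (use f in blast)
  moreover have "(f \<longlongrightarrow> l) at_top"
  proof (rule tendstoI)
    fix e :: real assume e: "e > 0"
    have "\<forall>\<^sub>F b in at_top. \<exists>z. P b z \<and> dist z l < e / 2" using e by (intro ev) simp
    then show "\<forall>\<^sub>F b in at_top. dist (f b) l < e"
      using eventually_gt_at_top[of "2 / e"]
    proof eventually_elim
      case (elim b)
      then obtain z where z: "P b z" "dist z l < e / 2" by blast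
      have "0 < 2 / e" using e by simp
      also have "\<dots> < b" using elim by blast
      finally have b0: "b > 0" .
      then have b: "b > 0" "1 / b < e / 2" using elim(2) e by (simp_all add: field_simps)
      have "Inf (Q b) \<le> dist z l" using z bdd by (intro cInf_lower) (auto simp: Q_def)
      then show ?case using f[OF z(1) b(1)] z(2) b(2) by linarith
    qed
  qed
  ultimately show ?thesis by blast
qed

lemma ln_norm_complex: "ln (norm \<xi>) = ln ((Re \<xi>)\<^sup>2 + (Im \<xi>)\<^sup>2) / 2"
  by (simp add: cmod_def ln_sqrt)

text \<open>A vertical move changes \<open>norm \<xi>\<close> and leaves \<open>Re \<xi>\<close>
  fixed. Just above the curve the rate is therefore negative and just below it positive, which
  supplies the set \<open>U\<close> and the point \<open>w\<close> for
  \<open>eventually_has_zero\<close>.\<close>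

lemma hyp1F1_zero_near_upper:
  fixes a :: real and \<xi>0 :: complex
  assumes a: "a > 0" and S: "\<xi>0 \<in> S_plus" and im: "Im \<xi>0 > 0" and e: "e > 0"
  shows "\<forall>\<^sub>F b in at_top. \<exists>\<xi>. hyp1F1 (of_real a) (of_real b) (of_real b * \<xi>) = 0 \<and> dist \<xi> \<xi>0 < e"
proof -
  have eq: "Re \<xi>0 - 1 = ln (norm \<xi>0)" and re: "Re \<xi>0 \<ge> 1"
    using S by (auto simp: S_plus_def ln_norm_complex)
  have re1: "Re \<xi>0 > 1"
  proof (rule ccontr)
    assume "\<not> Re \<xi>0 > 1"
    then have "Re \<xi>0 = 1" "ln (norm \<xi>0) = 0" using re eq by auto
    moreover have "norm \<xi>0 > 0" using im by auto
    ultimately have "Re \<xi>0 = 1" "norm \<xi>0 = 1" by (simp_all only: ln_eq_zero_iff)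
    then show False using im by (simp add: cmod_def)
  qed
  \<comment> \<open>The disc must stay in \<open>Re z > 1\<close>, \<open>Im z > 0\<close>, where
    the splitting is valid.\<close>
  define r where "r = min e (min (Re \<xi>0 - 1) (Im \<xi>0))"
  have r: "r > 0" "r \<le> e" "r \<le> Re \<xi>0 - 1" "r \<le> Im \<xi>0" using e im re1 by (auto simp: r_def)
  have D: "Re z > 1" "Im z > 0" if "z \<in> ball \<xi>0 r" for z
    using that r abs_Re_le_cmod[of "\<xi>0 - z"] abs_Im_le_cmod[of "\<xi>0 - z"] by (auto simp: dist_norm)
  have nz: "z \<noteq> 0" if "z \<in> ball \<xi>0 r" for z using D[OF that] by auto
  define U where "U = {z \<in> ball \<xi>0 r. Re z - 1 < ln (norm z)}"
  have "continuous_on (ball \<xi>0 r) (\<lambda>z. ln (norm z) - (Re z - 1))"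
    by (intro continuous_intros) (use nz in auto)
  then have "open ((\<lambda>z. ln (norm z) - (Re z - 1)) -` {0<..} \<inter> ball \<xi>0 r)"
    by (subst (asm) continuous_on_open_vimage) auto
  also have "(\<lambda>z. ln (norm z) - (Re z - 1)) -` {0<..} \<inter> ball \<xi>0 r = U" by (auto simp: U_def)
  finally have oU: "open U" .
  define t where "t = r / 2"
  have t: "0 < t" "t < r" "t < Im \<xi>0" using r by (auto simp: t_def)
  have "norm \<xi>0 < norm (\<xi>0 + \<i> * of_real t)"
    unfolding cmod_def using t im by (simp add: power_strict_mono)
  then have "ln (norm \<xi>0) < ln (norm (\<xi>0 + \<i> * of_real t))" using re1 by (subst ln_less_cancel_iff) auto
  then have "\<xi>0 + \<i> * of_real t \<in> U" using t eq by (simp add: U_def dist_norm norm_mult)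
  then have U: "U \<noteq> {}" "U \<subseteq> ball \<xi>0 r" by (auto simp: U_def)
  define w where "w = \<xi>0 - \<i> * of_real t"
  have w: "w \<in> ball \<xi>0 r" using t by (simp add: w_def dist_norm norm_mult)
  have "norm w < norm \<xi>0"
    unfolding cmod_def w_def using t by (simp add: power_strict_mono)
  then have "ln (norm w) < ln (norm \<xi>0)" using D[OF w] by (subst ln_less_cancel_iff) auto
  then have "Re w - 1 > ln (norm w)" using eq by (simp add: w_def)
  then obtain \<kappa> where \<kappa>: "\<kappa> > 0" "\<forall>\<^sub>F b in at_top. norm (scaled_hyp1F1 a b w) \<ge> exp (\<kappa> * b)"
    using scaled_hyp1F1_exponential_growth[OF a D[OF w]] by blast
  \<comment> \<open>One summand for each factor: \<open>b powr a\<close>, then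
    \<open>Beta a (b - a) \<le> Beta a 1\<close> for \<open>b \<ge> a + 1\<close>, then the series
    at an argument of modulus at most \<open>b * (norm \<xi>0 + r)\<close>.\<close>
  define M where "M = a + Beta a 1 + (norm \<xi>0 + r)"
  have "\<forall>\<^sub>F b in at_top. \<exists>z\<in>ball \<xi>0 r. scaled_hyp1F1 a b z = 0"
  proof (rule eventually_has_zero[where h = "scaled_hyp1F1 a" and M = M and ?b0.0 = "a + 1", OF _ _ oU U _ w \<kappa>])
    fix b assume b: "b \<ge> a + 1"
    have ab: "b > a" using b by simp
    show "scaled_hyp1F1 a b holomorphic_on ball \<xi>0 r"
      unfolding scaled_hyp1F1_def
      by (intro holomorphic_intros holomorphic_on_compose_gen[OF _ hyp1F1_holomorphic[OF a ab], unfolded o_def, where t = UNIV]) auto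
    fix z assume z: "z \<in> ball \<xi>0 r"
    have "norm z \<le> norm \<xi>0 + r" using z norm_triangle_sub[of z \<xi>0] by (auto simp: dist_norm norm_minus_commute)
    then have "norm (hyp1F1 (of_real a) (of_real b) (of_real b * z)) \<le> exp ((norm \<xi>0 + r) * b)"
      using norm_hyp1F1_le[OF a ab, of "of_real b * z"] ab a
      by (elim order_trans) (simp add: norm_mult mult.commute)
    moreover have "b powr a \<le> exp (a * b)"
    proof -
      have "b powr a \<le> (1 + b) powr a" using a ab by (intro powr_mono2) auto
      also have "\<dots> \<le> exp (\<bar>a\<bar> * b)" using a ab by (intro powr_le_exp) auto
      finally show ?thesis using a by simp
    qed
    moreover have "\<bar>Beta a (b - a)\<bar> \<le> exp (Beta a 1 * b)"
    proof -
      have "Beta a (b - a) > 0" "Beta a 1 > 0" using a ab by (simp_all add: Beta_def)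
      moreover have "Beta a (b - a) \<le> Beta a 1" by (rule Beta_real_mono) (use a b in auto)
      moreover have "Beta a 1 * 1 \<le> Beta a 1 * b" using a b calculation by (intro mult_left_mono) auto
      moreover have "1 + Beta a 1 * b \<le> exp (Beta a 1 * b)" by (rule exp_ge_add_one_self)
      ultimately show ?thesis by linarith
    qed
    ultimately have "norm (scaled_hyp1F1 a b z) \<le> (exp (a * b) * exp (Beta a 1 * b)) * exp ((norm \<xi>0 + r) * b)"
      unfolding scaled_hyp1F1_def norm_mult norm_of_real abs_mult by (intro mult_mono) auto
    also have "\<dots> = exp (M * b)" by (simp add: M_def exp_add[symmetric] algebra_simps)
    finally show "norm (scaled_hyp1F1 a b z) \<le> exp (M * b)" .
  next
    fix z assume "z \<in> U"
    then show "\<exists>L. L \<noteq> 0 \<and> ((\<lambda>b. scaled_hyp1F1 a b z) \<longlongrightarrow> L) at_top"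
      using D by (intro scaled_hyp1F1_tendsto a) (auto simp: U_def)
  qed
  then show ?thesis
    using eventually_gt_at_top[of a]
  proof eventually_elim
    case (elim b)
    then obtain z where z: "z \<in> ball \<xi>0 r" "scaled_hyp1F1 a b z = 0" by blast
    moreover have "b powr a * Beta a (b - a) > 0" using a elim by (simp add: Beta_def)
    then have "b powr a * Beta a (b - a) \<noteq> 0" by linarith
    ultimately have "hyp1F1 (of_real a) (of_real b) (of_real b * z) = 0"
      unfolding scaled_hyp1F1_def by (simp only: mult_eq_0_iff of_real_eq_0_iff) blast
    then show ?case using z r by (intro exI[of _ z]) (auto simp: dist_commute)
  qed
qed

text \<open>The curve is parametrised by \<open>d = Re \<xi> - 1\<close>: its equation says
  \<open>norm \<xi> = exp d\<close>, and \<open>exp d > 1 + d\<close> for \<open>d > 0\<close>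
  leaves a positive imaginary part that tends to 0 with \<open>d\<close>.\<close>

lemma S_plus_approaches_1:
  assumes "e > 0"
  shows "\<exists>\<xi>\<in>S_plus. Im \<xi> > 0 \<and> dist \<xi> 1 < e"
proof -
  define c where "c d = Complex (1 + d) (sqrt (exp d ^ 2 - (1 + d)\<^sup>2))" for d :: real
  have "((\<lambda>d. sqrt (exp d ^ 2 - (1 + d)\<^sup>2)) \<longlongrightarrow> sqrt (exp 0 ^ 2 - (1 + 0)\<^sup>2)) (at_right 0)"
    by (intro tendsto_intros)
  moreover have "((\<lambda>d. 1 + d :: real) \<longlongrightarrow> 1 + 0) (at_right 0)" by (intro tendsto_intros)
  ultimately have "(c \<longlongrightarrow> Complex (1 + 0) (sqrt (exp 0 ^ 2 - (1 + 0)\<^sup>2))) (at_right 0)"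
    unfolding c_def by (intro tendsto_Complex)
  then have "(c \<longlongrightarrow> 1) (at_right 0)" by (simp add: one_complex.code)
  then have "\<forall>\<^sub>F d in at_right 0. dist (c d) 1 < e" using assms by (rule tendstoD)
  then have "\<forall>\<^sub>F d in at_right 0. dist (c d) 1 < e \<and> d > (0::real)"
    by (simp add: eventually_conj_iff eventually_at_right_less)
  then obtain d :: real where d: "dist (c d) 1 < e" "d > 0"
    using eventually_happens'[OF trivial_limit_at_right_real] by blast
  have "(1 + d)\<^sup>2 < exp d ^ 2"
    using d exp_ge_add_one_self[of d] exp_minus_greater[of "- d"] by (intro power_strict_mono) auto
  then have "Im (c d) > 0" "(Re (c d))\<^sup>2 + (Im (c d))\<^sup>2 = exp d ^ 2" by (auto simp: c_def)
  moreover from this have "c d \<in> S_plus"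
    using d unfolding S_plus_def by (simp add: ln_realpow) (simp add: c_def)
  ultimately show ?thesis using d by blast
qed

text \<open>Lower points follow by conjugation. A disc around the real point would leave
  \<open>Re \<xi> > 1\<close>, so there the zeros near a nonreal point of the curve at distance
  below \<open>e / 2\<close> are used.\<close>

lemma hyp1F1_zero_near:
  fixes a :: real and \<xi>0 :: complex
  assumes a: "a > 0" and S: "\<xi>0 \<in> S_plus" and e: "e > 0"
  shows "\<forall>\<^sub>F b in at_top. \<exists>\<xi>. hyp1F1 (of_real a) (of_real b) (of_real b * \<xi>) = 0 \<and> dist \<xi> \<xi>0 < e"
proof -
  consider "Im \<xi>0 > 0" | "Im \<xi>0 < 0" | "Im \<xi>0 = 0" by linarith
  then show ?thesis
  proof cases
    case 1
    then show ?thesis using hyp1F1_zero_near_upper[OF a S _ e] by blast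
  next
    case 2
    have "cnj \<xi>0 \<in> S_plus" "Im (cnj \<xi>0) > 0" using S 2 by (auto simp: S_plus_def)
    from hyp1F1_zero_near_upper[OF a this e] show ?thesis
      using eventually_gt_at_top[of a]
    proof eventually_elim
      case (elim b)
      then obtain z where z: "hyp1F1 (of_real a) (of_real b) (of_real b * z) = 0" "dist z (cnj \<xi>0) < e" by blast
      have "hyp1F1 (of_real a) (of_real b) (of_real b * cnj z) = 0"
        using hyp1F1_cnj[OF a elim(2), of "of_real b * z"] z(1) by simp
      moreover have "dist (cnj z) \<xi>0 = dist z (cnj \<xi>0)"
        by (metis complex_cnj_cnj complex_cnj_diff complex_mod_cnj dist_norm)
      ultimately show ?case using z(2) by metis
    qed
  next
    case 3
    \<comment> \<open>On the real axis the equation reads \<open>ln x = x - 1\<close>, whose only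
      positive solution is 1.\<close>
    then have "Re \<xi>0 = 1"
      using S by (intro ln_eq_minus_one) (auto simp: S_plus_def ln_realpow)
    with 3 have 1: "\<xi>0 = 1" by (simp add: complex_eq_iff)
    obtain \<xi>1 where \<xi>1: "\<xi>1 \<in> S_plus" "Im \<xi>1 > 0" "dist \<xi>1 1 < e / 2"
      using S_plus_approaches_1[of "e / 2"] e by auto
    have "\<forall>\<^sub>F b in at_top. \<exists>\<xi>. hyp1F1 (of_real a) (of_real b) (of_real b * \<xi>) = 0 \<and> dist \<xi> \<xi>1 < e / 2"
      by (rule hyp1F1_zero_near_upper[OF a \<xi>1(1,2)]) (use e in simp)
    then show ?thesis
    proof eventually_elim
      case (elim b)
      then obtain z where z: "hyp1F1 (of_real a) (of_real b) (of_real b * z) = 0" "dist z \<xi>1 < e / 2" by blast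
      then have "dist z \<xi>0 < e" using \<xi>1(3) dist_triangle[of z 1 \<xi>1] unfolding 1 by simp
      then show ?case using z(1) by blast
    qed
  qed
qed

theorem theoremB5:
  fixes a :: real and \<xi>0 :: complex
  assumes "a > 0" and "\<xi>0 \<in> S_plus"
  shows "\<exists>z :: real \<Rightarrow> complex.
           (\<forall>\<^sub>F b in at_top. hyp1F1 (of_real a) (of_real b) (z b) = 0) \<and>
           ((\<lambda>b. z b / of_real b) \<longlongrightarrow> \<xi>0) at_top"
proof -
  obtain f where f: "\<forall>\<^sub>F b in at_top. hyp1F1 (of_real a) (of_real b) (of_real b * f b) = 0" "(f \<longlongrightarrow> \<xi>0) at_top"
    using ex_selection_tendsto[of "\<lambda>b z. hyp1F1 (of_real a) (of_real b) (of_real b * z) = 0" \<xi>0]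
      hyp1F1_zero_near[OF assms] by blast
  have "((\<lambda>b. of_real b * f b / of_real b) \<longlongrightarrow> \<xi>0) at_top"
  proof (rule Lim_transform_eventually[OF f(2)])
    show "\<forall>\<^sub>F b in at_top. f b = of_real b * f b / of_real b"
      using eventually_gt_at_top[of 0] by eventually_elim simp
  qed
  with f(1) show ?thesis by (intro exI[of _ "\<lambda>b. of_real b * f b"]) blast
qed

end
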